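(* Let $(X_n)_{n\ge 0}$ be a process with state space $S$ and laws $(\mathsf P_x)_{x\in S}$, and let $N\in\mathbb Z_+$, as described in the context. Assume that the following conditions hold. (Random memory depth) For every $n\ge 0$ and $j\in S$, $\mathsf P(X_{n+1}=j\mid\mathcal F_n)=\mathsf P(X_{n+1}=j\mid\widetilde{\mathcal F}_n)$. (Recurrence-1) There is a non-decreasing sequence $(\kappa_i)_{i\ge 0}$ in $(0,1]$ such that for every $k\ge 1$ and every $n\ge k-1$, on the event $\{N<X_n<X_{n-1}<\dots<X_{n-k+1}\}$ (for $k=1$: on $\{N<X_n\}$), $$\mathsf P(X_{n+1}<X_n\mid\widetilde{\mathcal F}_n)\ge\kappa_{k-1}.$$ (Recurrence-2) For every real $m>0$, $\sum_{i\ge 1}i^m(1-\kappa_i)<\infty$; moreover $\prod_{i=0}^\infty\kappa_i>0$. (Moments of upward jumps) For every real $m>0$ there is a constant $M_m<\infty$ such that for all $n\ge 0$, almost surely, $\mathsf E\big(((X_{n+1}-X_n)_+)^m\mid\widetilde{\mathcal F}_n\big)\le M_m$. Let $\tau:=\inf\{t\ge 0: X_t\le N\}$. Then for every real $m>0$ there exist constants $C_1<\infty$ and $C_2<\infty$ (not depending on $x$) such that for all $x\in S$, $$\mathsf E_x\tau^m\le C_1\,(C_2+x^m).$$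
   Context: The state space $S$ is either $\mathbb Z_+=\{0,1,2,\dots\}$ or $\{0,\dots,\widetilde N\}$ for some finite $\widetilde N\in\mathbb N$. $(X_n)_{n\ge 0}$ is a discrete-time $S$-valued process, not necessarily Markov. For $x\in S$, $\mathsf P_x$ and $\mathsf E_x$ denote the law and expectation of the process started at $X_0=x$. $N\in\mathbb Z_+$ is a fixed level. $(\mathcal F_n)_{n\ge0}$ is the natural filtration of $(X_n)$, $\mathcal F_n=\sigma(X_0,\dots,X_n)$, and $a_+=\max(a,0)$. For $n\ge 0$ define $$\zeta_n:=\inf\{0\le k\le n:\ X_{i+1}-X_i<0\ \ \forall i=k,\dots,n-1\},$$ where the condition is vacuous for $k=n$ (so $\zeta_n$ is the start of the current run of strict decrease ending at time $n$, and $\zeta_n=n$ if $n=0$ or $X_{n-1}\le X_n$). Put $$\hat X_{i,n}:=X_i\,\mathbf 1(\zeta_n\le i\le n),\qquad \widetilde{\mathcal F}_n:=\sigma(\zeta_n;\ \hat X_{i,n}:\ 0\le i\le n).$$ Then $\widetilde{\mathcal F}_n\subset\mathcal F_n$, but $(\widetilde{\mathcal F}_n)$ is not a filtration. All (in)equalities between conditional probabilities or expectations are understood almost surely. The conditions are required under every $\mathsf P_x$, $x\in S$, with constants $\kappa_i$, $M_m$ not depending on $x$. By convention $\inf\emptyset=+\infty$ in the definition of $\tau$. *)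

theory Defs
  imports "HOL-Probability.Probability"
begin

definition generated_algebra :: "'a measure \<Rightarrow> ('a \<Rightarrow> nat) set \<Rightarrow> 'a measure" where
  "generated_algebra \<Omega> Zs = sigma (space \<Omega>) {Z -` A \<inter> space \<Omega> | Z A. Z \<in> Zs}"

definition natural_algebra :: "'a measure \<Rightarrow> (nat \<Rightarrow> 'a \<Rightarrow> nat) \<Rightarrow> nat \<Rightarrow> 'a measure" where
  "natural_algebra \<Omega> X n = generated_algebra \<Omega> (X ` {..n})"

definition run_start :: "(nat \<Rightarrow> 'a \<Rightarrow> nat) \<Rightarrow> nat \<Rightarrow> 'a \<Rightarrow> nat" where
  "run_start X n \<omega> = Inf {k. k \<le> n \<and> (\<forall>i\<in>{k..<n}. X (Suc i) \<omega> < X i \<omega>)}"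

definition run_value :: "(nat \<Rightarrow> 'a \<Rightarrow> nat) \<Rightarrow> nat \<Rightarrow> nat \<Rightarrow> 'a \<Rightarrow> nat" where
  "run_value X i n \<omega> = (if run_start X n \<omega> \<le> i \<and> i \<le> n then X i \<omega> else 0)"

definition memory_algebra :: "'a measure \<Rightarrow> (nat \<Rightarrow> 'a \<Rightarrow> nat) \<Rightarrow> nat \<Rightarrow> 'a measure" where
  "memory_algebra \<Omega> X n =
     generated_algebra \<Omega> (insert (run_start X n) ((\<lambda>i. run_value X i n) ` {..n}))"

(* The infimum is taken in enat, so it is \<infinity> when the level is never reached. *)
definition hitting_time :: "(nat \<Rightarrow> 'a \<Rightarrow> nat) \<Rightarrow> nat \<Rightarrow> 'a \<Rightarrow> enat" where
  "hitting_time X N \<omega> = Inf (enat ` {t. X t \<omega> \<le> N})"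

(* Intended for exponents m > 0 only. *)
definition enat_powr :: "enat \<Rightarrow> real \<Rightarrow> ennreal" where
  "enat_powr t m = (case t of enat k \<Rightarrow> ennreal (real k powr m) | \<infinity> \<Rightarrow> \<infinity>)"

(* All laws P x live on the common measurable space \<Omega>; the measure carried by \<Omega> itself
   plays no role. *)
definition process_with_laws ::
    "nat set \<Rightarrow> 'a measure \<Rightarrow> (nat \<Rightarrow> 'a measure) \<Rightarrow> (nat \<Rightarrow> 'a \<Rightarrow> nat) \<Rightarrow> bool" where
  "process_with_laws S \<Omega> P X \<longleftrightarrow>
     (\<forall>n. X n \<in> measurable \<Omega> (count_space S)) \<and>
     (\<forall>x\<in>S. prob_space (P x) \<and> sets (P x) = sets \<Omega> \<and> (AE \<omega> in P x. X 0 \<omega> = x))"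

definition random_memory_depth ::
    "nat set \<Rightarrow> 'a measure \<Rightarrow> (nat \<Rightarrow> 'a measure) \<Rightarrow> (nat \<Rightarrow> 'a \<Rightarrow> nat) \<Rightarrow> bool" where
  "random_memory_depth S \<Omega> P X \<longleftrightarrow>
     (\<forall>x\<in>S. \<forall>n. \<forall>j\<in>S. AE \<omega> in P x.
        real_cond_exp (P x) (natural_algebra \<Omega> X n)
          (indicator {\<omega> \<in> space \<Omega>. X (Suc n) \<omega> = j}) \<omega> =
        real_cond_exp (P x) (memory_algebra \<Omega> X n)
          (indicator {\<omega> \<in> space \<Omega>. X (Suc n) \<omega> = j}) \<omega>)"

(* Lower index n + 1 - k rather than n - k + 1: subtraction on nat truncates when k = n + 1. *)
definition recurrence1 ::
    "nat set \<Rightarrow> 'a measure \<Rightarrow> (nat \<Rightarrow> 'a measure) \<Rightarrow> (nat \<Rightarrow> 'a \<Rightarrow> nat) \<Rightarrow> nat \<Rightarrow>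
     (nat \<Rightarrow> real) \<Rightarrow> bool" where
  "recurrence1 S \<Omega> P X N \<kappa> \<longleftrightarrow>
     mono \<kappa> \<and> (\<forall>i. 0 < \<kappa> i \<and> \<kappa> i \<le> 1) \<and>
     (\<forall>x\<in>S. \<forall>k\<ge>1. \<forall>n\<ge>k - 1. AE \<omega> in P x.
        N < X n \<omega> \<and> (\<forall>i\<in>{n + 1 - k..<n}. X (Suc i) \<omega> < X i \<omega>) \<longrightarrow>
        real_cond_exp (P x) (memory_algebra \<Omega> X n)
          (indicator {\<omega> \<in> space \<Omega>. X (Suc n) \<omega> < X n \<omega>}) \<omega> \<ge> \<kappa> (k - 1))"

(* prodinf is unspecified for a product diverging to 0, hence the explicit convergence. *)
definition recurrence2 :: "(nat \<Rightarrow> real) \<Rightarrow> bool" where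
  "recurrence2 \<kappa> \<longleftrightarrow>
     (\<forall>m::real. m > 0 \<longrightarrow> summable (\<lambda>i. real (Suc i) powr m * (1 - \<kappa> (Suc i)))) \<and>
     convergent_prod \<kappa> \<and> prodinf \<kappa> > 0"

(* nn_cond_exp, since integrability of the jumps is part of what is asserted;
   real_cond_exp yields junk values where the conditional expectation is infinite. *)
definition upward_jump_moments ::
    "nat set \<Rightarrow> 'a measure \<Rightarrow> (nat \<Rightarrow> 'a measure) \<Rightarrow> (nat \<Rightarrow> 'a \<Rightarrow> nat) \<Rightarrow> bool" where
  "upward_jump_moments S \<Omega> P X \<longleftrightarrow>
     (\<forall>m::real. m > 0 \<longrightarrow> (\<exists>M::real. M \<ge> 0 \<and> (\<forall>x\<in>S. \<forall>n. AE \<omega> in P x.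
        nn_cond_exp (P x) (memory_algebra \<Omega> X n)
          (\<lambda>\<omega>. ennreal (max (real (X (Suc n) \<omega>) - real (X n \<omega>)) 0 powr m)) \<omega> \<le> ennreal M)))"

end

theory Submission
  imports Defs "HOL-Real_Asymp.Real_Asymp"
begin

text \<open>Why the theorem holds. Let \<open>r\<^sub>n\<close> be the length of the current run of strict decrease, that is
\<open>n - run_start X n\<close>. The position alone need not drift downwards: with
probability up to \<open>1 - \<kappa> 0\<close> a fresh run fails at once, at the price of an upward jump. What saves
the day is that a run that has already lasted for \<open>r\<close> steps fails with probability at most
\<open>1 - \<kappa> r\<close>, and that these probabilities are so small that a run of any length succeeds with
probability at least \<open>\<Prod>i. \<kappa> i > 0\<close>. A bounded non-increasing correction \<open>b\<close> of the run length
turns this into a genuine drift: \<open>V\<^sub>n = X\<^sub>n + b (r\<^sub>n)\<close> loses in conditional mean at least a constant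
proportional to \<open>\<kappa> 0\<close> at each step above the level \<open>N\<close>. One takes \<open>b = B - D\<close>, where \<open>D r\<close> is the
credit that a run of length \<open>r\<close> has to have accumulated in order to pay for its possible failure.
It solves \<open>D (r+1) * \<kappa> r = D r + \<epsilon> r\<close> with \<open>\<epsilon> r\<close> a bound for the expected jump on failure, and it is
bounded because \<open>\<epsilon>\<close> is summable and the product of \<open>\<kappa>\<close> is positive
(\<open>bounded_run_potential\<close>). The expected height of the jump on failure is estimated by
\<open>J * 1\<^sub>U \<le> s * J\<^sup>2 + 1\<^sub>U / s\<close> (\<open>U\<close> the event of failure) with \<open>s = 1 / r\<^sup>2\<close>; this is the point where the second moment of
the jumps and the summability of \<open>r\<^sup>2 * (1 - \<kappa> r)\<close> enter.

From drift to moments. Upward moves of \<open>V\<close> have bounded conditional moments of all orders, and in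
the estimate a downward move counts only with a bounded size \<open>d\<close>. Hence, for an integer exponent \<open>K\<close>,
the second-order expansion of the \<open>K\<close>th power of \<open>Z\<^sub>n = V\<^sub>n + \<gamma> * n + L\<close> has a conditional error of
order \<open>Z\<^sub>n\<close> to the power \<open>K - 2\<close>, which for a large constant \<open>L\<close> is absorbed by the negative
first-order term. So the \<open>K\<close>th power of \<open>Z\<close> is a supermartingale up to the hitting time \<open>\<tau>\<close>
(\<open>drift_step\<close>, \<open>inflated_potential_is_supermartingale\<close>). As \<open>Z\<^sub>n \<ge> \<gamma> * n\<close>, the \<open>K\<close>th moment of
\<open>\<gamma> * min n \<tau>\<close> is at most \<open>s\<close> to the power \<open>K\<close> with \<open>s = x + B + L\<close>
(\<open>truncated_time_moment\<close>). Real exponents \<open>p \<le> K\<close> and the passage to \<open>\<tau>\<close> itself follow by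
comparing powers at the scale \<open>s\<close> and by monotone convergence (\<open>moment_of_truncated_moments\<close>).

The estimates for conditional laws are given relative to the memory algebra, whereas the
supermartingale property concerns events of the whole past. The random memory depth condition
bridges the gap for every function of \<open>X\<^sub>n\<close> and \<open>X\<^sub>n\<^sub>+\<^sub>1\<close> (\<open>cond_exp_natural_eq_memory\<close>).\<close>

section \<open>Inequalities for powers\<close>

text \<open>The second-order Taylor bound for a power, in a form in which the remainder carries \<open>z\<close> to
the power \<open>k\<close> and a factor that depends on the increment only; increments of both signs occur later.
The proof is an induction on the remainder; its bound obeys the same recursion as the remainder itself.\<close>

lemma power_add_le_second_order:
  fixes z w :: real
  assumes z: "z \<ge> 1"
  shows "(z + w) ^ (k + 2) \<le> z ^ (k + 2) + real (k + 2) * z ^ (k + 1) * w + z ^ k * (1 + \<bar>w\<bar>) ^ (k + 2)"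
proof -
  \<comment> \<open>\<open>R\<close> is the remainder, and \<open>S\<close> is its value at \<open>z = 1\<close> and \<open>w = \<bar>w\<bar>\<close>.\<close>
  define R where "R k = (z + w) ^ (k + 2) - z ^ (k + 2) - real (k + 2) * z ^ (k + 1) * w" for k
  define S where "S k = (1 + \<bar>w\<bar>) ^ (k + 2) - 1 - real (k + 2) * \<bar>w\<bar>" for k
  have main: "\<bar>R k\<bar> \<le> z ^ k * S k" for k
  proof (induction k)
    case 0
    show ?case by (simp add: R_def S_def power2_eq_square algebra_simps flip: abs_mult)
  next
    case (Suc k)
    have R: "R (Suc k) = (z + w) * R k + real (k + 2) * z ^ (k + 1) * w\<^sup>2"
      unfolding R_def by (simp add: algebra_simps power2_eq_square)
    have S: "S (Suc k) = (1 + \<bar>w\<bar>) * S k + real (k + 2) * w\<^sup>2"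
      unfolding S_def by (simp add: algebra_simps power2_eq_square flip: abs_mult)
    have "\<bar>z + w\<bar> \<le> z * (1 + \<bar>w\<bar>)"
    proof -
      have "\<bar>w\<bar> \<le> z * \<bar>w\<bar>" using z by (simp add: mult_le_cancel_right1)
      then show ?thesis using z by (simp add: algebra_simps)
    qed
    then have "\<bar>(z + w) * R k\<bar> \<le> (z * (1 + \<bar>w\<bar>)) * (z ^ k * S k)"
      unfolding abs_mult using Suc.IH z by (intro mult_mono) auto
    moreover have "\<bar>real (k + 2) * z ^ (k + 1) * w\<^sup>2\<bar> = real (k + 2) * z ^ (k + 1) * w\<^sup>2"
      using z by simp
    ultimately have "\<bar>R (Suc k)\<bar> \<le> (z * (1 + \<bar>w\<bar>)) * (z ^ k * S k) + real (k + 2) * z ^ (k + 1) * w\<^sup>2"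
      unfolding R by linarith
    also have "\<dots> = z ^ Suc k * S (Suc k)" unfolding S by (simp add: algebra_simps)
    finally show ?case .
  qed
  have "R k \<le> z ^ k * S k" using main[of k] by linarith
  also have "\<dots> \<le> z ^ k * (1 + \<bar>w\<bar>) ^ (k + 2)"
  proof (rule mult_left_mono)
    have "0 \<le> real (k + 2) * \<bar>w\<bar>" by simp
    then show "S k \<le> (1 + \<bar>w\<bar>) ^ (k + 2)" unfolding S_def by linarith
  qed (use z in simp)
  finally show ?thesis unfolding R_def by linarith
qed

lemma power_add_le_two_power:
  fixes a b :: real
  assumes "0 \<le> a" "0 \<le> b"
  shows "(a + b) ^ n \<le> 2 ^ n * (a ^ n + b ^ n)"
proof -
  have "(a + b) ^ n \<le> (2 * max a b) ^ n" using assms by (intro power_mono) auto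
  also have "\<dots> = 2 ^ n * max a b ^ n" by (simp add: power_mult_distrib)
  also have "max a b ^ n \<le> a ^ n + b ^ n" using assms by (simp add: max_def)
  finally show ?thesis by simp
qed

lemma powr_add_le_two_powr:
  fixes a b p :: real
  assumes "0 \<le> a" "0 \<le> b" "0 < p"
  shows "(a + b) powr p \<le> 2 powr p * (a powr p + b powr p)"
proof -
  have "(a + b) powr p \<le> (2 * max a b) powr p" using assms by (intro powr_mono2) auto
  also have "\<dots> = 2 powr p * max a b powr p" using assms by (simp add: powr_mult)
  also have "max a b powr p \<le> a powr p + b powr p" by (simp add: max_def)
  finally show ?thesis by simp
qed

section \<open>A bounded correction for the run length\<close>

text \<open>The credit \<open>D\<close> grows by two mechanisms: division by \<open>\<kappa> r\<close> and addition of the costs \<open>\<epsilon> r\<close>. Multiplied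
by the partial products of \<open>\<kappa>\<close>, it is dominated by the partial sums of \<open>\<epsilon>\<close>. The partial products
are bounded below by the infinite product, whence \<open>D\<close> stays bounded.\<close>

lemma bounded_run_potential:
  fixes \<kappa> \<epsilon> :: "nat \<Rightarrow> real"
  assumes \<kappa>: "\<And>i. 0 < \<kappa> i" "\<And>i. \<kappa> i \<le> 1"
    and conv: "convergent_prod \<kappa>" "prodinf \<kappa> > 0"
    and \<epsilon>: "\<And>i. 0 \<le> \<epsilon> i" "summable \<epsilon>"
  obtains D :: "nat \<Rightarrow> real" and B :: real where
    "D 0 = 0" "\<And>r. D (Suc r) * \<kappa> r = D r + \<epsilon> r" "mono D" "\<And>r. 0 \<le> D r" "\<And>r. D r \<le> B"
proof -
  define D where "D = rec_nat 0 (\<lambda>r x. (x + \<epsilon> r) / \<kappa> r)"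
  have D0: "D 0 = 0" and DS: "D (Suc r) = (D r + \<epsilon> r) / \<kappa> r" for r by (simp_all add: D_def)
  have rec: "D (Suc r) * \<kappa> r = D r + \<epsilon> r" for r using \<kappa>(1)[of r] by (simp add: DS)
  have nonneg: "0 \<le> D r" for r
    by (induction r) (use \<kappa>(1) \<epsilon>(1) in \<open>auto simp: D0 DS intro!: divide_nonneg_pos add_nonneg_nonneg\<close>)
  have step: "D r \<le> D (Suc r)" for r
  proof -
    have "D r \<le> D (Suc r) * \<kappa> r" using rec \<epsilon>(1)[of r] by simp
    also have "\<dots> \<le> D (Suc r)" using nonneg[of "Suc r"] \<kappa>(2)[of r] by (simp add: mult_left_le)
    finally show ?thesis .
  qed
  define p where "p r = (\<Prod>i<r. \<kappa> i)" for r
  have p: "0 < p r" "p r \<le> 1" for r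
    unfolding p_def using \<kappa> by (auto intro!: prod_pos prod_le_1 simp: less_imp_le)
  have lower: "prodinf \<kappa> \<le> p r" for r
  proof (rule LIMSEQ_le_const2)
    show "(\<lambda>n. p (Suc n)) \<longlonglongrightarrow> prodinf \<kappa>"
      using convergent_prod_LIMSEQ[OF conv(1)] by (simp add: p_def lessThan_Suc_atMost)
    have dec: "decseq p" unfolding p_def
      using \<kappa> by (intro decseq_SucI) (auto intro!: mult_left_le prod_nonneg simp: less_imp_le)
    have "p (Suc n) \<le> p r" if "n \<ge> r" for n using that by (intro decseqD[OF dec]) simp
    then show "\<exists>n0. \<forall>n\<ge>n0. p (Suc n) \<le> p r" by blast
  qed
  have "D r * p r \<le> (\<Sum>i<r. \<epsilon> i)" for r
  proof (induction r)
    case 0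
    show ?case by (simp add: D0)
  next
    case (Suc r)
    have "D (Suc r) * p (Suc r) = (D (Suc r) * \<kappa> r) * p r" by (simp add: p_def)
    also have "\<dots> = D r * p r + \<epsilon> r * p r" by (simp only: rec distrib_right)
    also have "\<dots> \<le> (\<Sum>i<r. \<epsilon> i) + \<epsilon> r"
      using Suc \<epsilon>(1)[of r] p[of r] by (intro add_mono) (auto simp: mult_left_le)
    finally show ?case by simp
  qed
  then have "D r * prodinf \<kappa> \<le> suminf \<epsilon>" for r
    using mult_left_mono[OF lower nonneg, of r r] sum_le_suminf[OF \<epsilon>(2), of "{..<r}"] \<epsilon>(1)
    by (meson finite_lessThan order_trans)
  then have "D r \<le> suminf \<epsilon> / prodinf \<kappa>" for r using conv(2) by (simp add: field_simps)
  moreover have "mono D" using step by (simp add: mono_iff_le_Suc)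
  ultimately show ?thesis using that D0 rec nonneg by blast
qed

section \<open>Drift of a power of the potential\<close>

lemma (in finite_measure_subalgebra) nn_cond_exp_indicator:
  assumes A: "A \<in> sets M"
  shows "AE x in M. nn_cond_exp M F (indicator A) x = ennreal (real_cond_exp M F (indicator A) x)"
proof -
  have eq: "(\<lambda>x. ennreal (indicator A x)) = indicator A"
      "(\<lambda>x. ennreal (- indicator A x)) = (\<lambda>_. 0)"
    by (auto simp: indicator_def ennreal_neg)
  have "AE x in M. nn_cond_exp M F (indicator A) x \<le> nn_cond_exp M F (\<lambda>_. 1) x"
    using A by (intro nn_cond_exp_mono) (auto simp: indicator_def)
  moreover have "AE x in M. 1 = nn_cond_exp M F (\<lambda>_. 1) x"
    by (rule nn_cond_exp_F_meas) auto
  moreover have "AE x in M. 0 = nn_cond_exp M F (\<lambda>_. 0) x"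
    by (rule nn_cond_exp_F_meas) auto
  ultimately show ?thesis
    unfolding real_cond_exp_def eq
  proof eventually_elim
    case (elim x)
    then have "nn_cond_exp M F (indicator A) x < \<top>"
      by (metis ennreal_one_less_top le_less_trans)
    with elim show ?case by (metis diff_zero enn2real_0 ennreal_enn2real)
  qed
qed

text \<open>Integrating a conditional bound against a known factor reduces the later estimates to integrals of
products, in place of conditional expectations of sums.\<close>

lemma (in sigma_finite_subalgebra) nn_integral_mult_le_cond_bound:
  fixes G h H :: "'a \<Rightarrow> ennreal"
  assumes [measurable]: "G \<in> borel_measurable F" "h \<in> borel_measurable M"
    and le: "AE x in M. G x * nn_cond_exp M F h x \<le> G x * H x"
  shows "(\<integral>\<^sup>+x. G x * h x \<partial>M) \<le> (\<integral>\<^sup>+x. G x * H x \<partial>M)"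
  by (subst nn_cond_exp_intg[symmetric]) (auto intro: nn_integral_mono_AE le)

text \<open>One step of the power of the potential, before any expectation is taken: \<open>z\<close> is the present value,
\<open>z'\<close> the next one, \<open>u\<close> says that the run fails, \<open>j\<close> is the jump. The right-hand side is a combination
of \<open>1\<close>, \<open>of_bool u\<close>, \<open>j\<^sup>2\<close> and a high power of \<open>j\<close> with coefficients known before the step, and all
but the negative drift term are nonnegative. The product of the jump with the event of failure, whose expectation is not
under direct control, has been split by the inequality of the means with weight \<open>s\<close>.\<close>

lemma drift_step_pointwise:
  fixes z z' j d e s A :: real
  assumes z: "z \<ge> 1" and z': "0 \<le> z'" "z' \<le> z + (if u then j + e else - d)"
    and j: "0 \<le> j" and d: "0 \<le> d" "d \<le> A" and e: "0 \<le> e" "e \<le> A" and s: "0 < s"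
  shows "z' ^ (k + 2) \<le> (z ^ (k + 2) - real (k + 2) * d * z ^ (k + 1))
     + (real (k + 2) * (d + e + 1 / s) * z ^ (k + 1)) * of_bool u
     + (real (k + 2) * s * z ^ (k + 1)) * j ^ 2
     + 2 ^ (k + 2) * (1 + A) ^ (k + 2) * z ^ k + (2 ^ (k + 2) * z ^ k) * j ^ (k + 2)"
proof -
  define w where "w = (if u then j + e else - d)"
  have "z' ^ (k + 2) \<le> (z + w) ^ (k + 2)"
    using z' unfolding w_def by (intro power_mono) auto
  also have "\<dots> \<le> z ^ (k + 2) + real (k + 2) * z ^ (k + 1) * w + z ^ k * (1 + \<bar>w\<bar>) ^ (k + 2)"
    by (rule power_add_le_second_order[OF z])
  also have "real (k + 2) * z ^ (k + 1) * w
      \<le> real (k + 2) * z ^ (k + 1) * (- d + (d + e + 1 / s) * of_bool u + s * j ^ 2)"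
  proof (rule mult_left_mono)
    have "0 \<le> (1 - s * j)\<^sup>2 / s" using s by simp
    also have "\<dots> = 1 / s + s * j\<^sup>2 - 2 * j"
      using s by (simp add: power2_eq_square field_simps)
    finally have "j \<le> 1 / s + s * j\<^sup>2" using j by linarith
    moreover have "0 \<le> s * j\<^sup>2" using s by simp
    ultimately show "w \<le> - d + (d + e + 1 / s) * of_bool u + s * j ^ 2"
      unfolding w_def by auto
  qed (use z in auto)
  also have "z ^ k * (1 + \<bar>w\<bar>) ^ (k + 2) \<le> z ^ k * (2 ^ (k + 2) * ((1 + A) ^ (k + 2) + j ^ (k + 2)))"
  proof (rule mult_left_mono)
    have "(1 + \<bar>w\<bar>) ^ (k + 2) \<le> ((1 + A) + j) ^ (k + 2)"
      unfolding w_def using j d e by (intro power_mono) auto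
    also have "\<dots> \<le> 2 ^ (k + 2) * ((1 + A) ^ (k + 2) + j ^ (k + 2))"
      using d j by (intro power_add_le_two_power) auto
    finally show "(1 + \<bar>w\<bar>) ^ (k + 2) \<le> 2 ^ (k + 2) * ((1 + A) ^ (k + 2) + j ^ (k + 2))" .
  qed (use z in auto)
  finally show ?thesis by (simp add: algebra_simps)
qed

text \<open>The supermartingale step in abstract form: \<open>T\<close> is the event that the target has not been reached,
\<open>r\<close> the run length, \<open>U\<close> the failure of the run, \<open>J\<close> the upward jump. The hypothesis \<open>gain\<close> says
that the drift wins by \<open>\<gamma>\<close> to first order; the last lower bound on \<open>L\<close> makes that surplus absorb the second-order
terms. The condition \<open>(k + 2) * A \<le> L\<close> keeps the coefficient of \<open>1\<close> nonnegative, so that all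
integrals are of nonnegative functions and nothing infinite is subtracted.\<close>

lemma (in finite_measure_subalgebra) drift_step:
  fixes Z Z' J :: "'a \<Rightarrow> real" and r :: "'a \<Rightarrow> nat" and d e s \<delta> :: "nat \<Rightarrow> real"
  assumes meas [measurable]: "T \<in> sets F" "Z \<in> borel_measurable F" "r \<in> measurable F (count_space UNIV)"
      "Z' \<in> borel_measurable M" "J \<in> borel_measurable M" "U \<in> sets M"
    and Z: "\<And>x. x \<in> T \<Longrightarrow> L \<le> Z x"
    and Z': "\<And>x. x \<in> T \<Longrightarrow> 0 \<le> Z' x"
      "\<And>x. x \<in> T \<Longrightarrow> Z' x \<le> Z x + (if x \<in> U then J x + e (r x) else - d (r x))"
    and J: "\<And>x. x \<in> T \<Longrightarrow> 0 \<le> J x"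
    and d: "\<And>i. 0 \<le> d i" "\<And>i. d i \<le> A" and e: "\<And>i. 0 \<le> e i" "\<And>i. e i \<le> A"
    and s: "\<And>i. 0 < s i" and \<delta>: "\<And>i. 0 \<le> \<delta> i" and m: "0 \<le> mq" "0 \<le> mk" and \<gamma>: "0 < \<gamma>"
    and cond_U: "AE x in M. x \<in> T \<longrightarrow> nn_cond_exp M F (indicator U) x \<le> ennreal (\<delta> (r x))"
    and cond_2: "AE x in M. x \<in> T \<longrightarrow> nn_cond_exp M F (\<lambda>x. ennreal (J x ^ 2)) x \<le> ennreal mq"
    and cond_k: "AE x in M. x \<in> T \<longrightarrow> nn_cond_exp M F (\<lambda>x. ennreal (J x ^ (k + 2))) x \<le> ennreal mk"
    and gain: "\<And>i. (d i + e i + 1 / s i) * \<delta> i + s i * mq + \<gamma> \<le> d i"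
    and L: "1 \<le> L" "real (k + 2) * A \<le> L" "2 ^ (k + 2) * ((1 + A) ^ (k + 2) + mk) \<le> real (k + 2) * \<gamma> * L"
  shows "(\<integral>\<^sup>+x. indicator T x * ennreal (Z' x ^ (k + 2)) \<partial>M) \<le> (\<integral>\<^sup>+x. indicator T x * ennreal (Z x ^ (k + 2)) \<partial>M)"
proof -
  note from_F = measurable_from_subalg[OF subalg]
  have TM [measurable]: "T \<in> sets M" using meas(1) subalg by (auto simp: subalgebra_def)
  have A: "0 \<le> A" using d[of 0] by linarith
  \<comment> \<open>The coefficients of \<open>1\<close>, of the event \<open>U\<close>, of \<open>J\<^sup>2\<close> and of the high power of \<open>J\<close> in the pointwise bound.\<close>
  define G0 where "G0 x = Z x ^ (k + 2) - real (k + 2) * d (r x) * Z x ^ (k + 1)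
      + 2 ^ (k + 2) * (1 + A) ^ (k + 2) * Z x ^ k" for x
  define G1 where "G1 x = real (k + 2) * (d (r x) + e (r x) + 1 / s (r x)) * Z x ^ (k + 1)" for x
  define G2 where "G2 x = real (k + 2) * s (r x) * Z x ^ (k + 1)" for x
  define G3 where "G3 x = 2 ^ (k + 2) * Z x ^ k" for x
  have [measurable]: "G0 \<in> borel_measurable F" "G1 \<in> borel_measurable F" "G2 \<in> borel_measurable F"
    "G3 \<in> borel_measurable F"
    unfolding G0_def G1_def G2_def G3_def by measurable
  then have [measurable]: "G0 \<in> borel_measurable M" "G1 \<in> borel_measurable M" "G2 \<in> borel_measurable M"
    "G3 \<in> borel_measurable M" "r \<in> measurable M (count_space UNIV)"
    using meas(3) by (auto intro: from_F)
  have ZT: "1 \<le> Z x" "real (k + 2) * A \<le> Z x" if "x \<in> T" for x using Z[OF that] L by auto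
  have G: "0 \<le> G0 x" "0 \<le> G1 x" "0 \<le> G2 x" "0 \<le> G3 x" if x: "x \<in> T" for x
  proof -
    have "real (k + 2) * d (r x) \<le> real (k + 2) * A" using d(2) by (intro mult_left_mono) auto
    then have "real (k + 2) * d (r x) * Z x ^ (k + 1) \<le> Z x * Z x ^ (k + 1)"
      using ZT[OF x] by (intro mult_right_mono) (linarith, simp)
    then show "0 \<le> G0 x" unfolding G0_def using ZT[OF x] A by simp
  qed (use ZT[OF x] d(1) e(1) s in \<open>auto simp: G1_def G2_def G3_def less_imp_le intro!: mult_nonneg_nonneg add_nonneg_nonneg\<close>)
  have "(\<integral>\<^sup>+x. indicator T x * ennreal (Z' x ^ (k + 2)) \<partial>M)
    \<le> (\<integral>\<^sup>+x. indicator T x * ennreal (G0 x) + (indicator T x * ennreal (G1 x)) * indicator U x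
        + (indicator T x * ennreal (G2 x)) * ennreal (J x ^ 2)
        + (indicator T x * ennreal (G3 x)) * ennreal (J x ^ (k + 2)) \<partial>M)"
  proof (rule nn_integral_mono)
    fix x assume "x \<in> space M"
    show "indicator T x * ennreal (Z' x ^ (k + 2)) \<le> indicator T x * ennreal (G0 x)
        + (indicator T x * ennreal (G1 x)) * indicator U x
        + (indicator T x * ennreal (G2 x)) * ennreal (J x ^ 2)
        + (indicator T x * ennreal (G3 x)) * ennreal (J x ^ (k + 2))"
    proof (cases "x \<in> T")
      case True
      have "Z' x ^ (k + 2) \<le> G0 x + G1 x * of_bool (x \<in> U) + G2 x * J x ^ 2 + G3 x * J x ^ (k + 2)"
        using drift_step_pointwise[OF ZT(1)[OF True] Z'[OF True] J[OF True]
            d[of "r x"] e[of "r x"] s[of "r x"], of k]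
        unfolding G0_def G1_def G2_def G3_def by linarith
      then have "ennreal (Z' x ^ (k + 2))
          \<le> ennreal (G0 x + G1 x * of_bool (x \<in> U) + G2 x * J x ^ 2 + G3 x * J x ^ (k + 2))"
        by (rule ennreal_leI)
      also have "\<dots> = ennreal (G0 x) + ennreal (G1 x) * indicator U x + ennreal (G2 x) * ennreal (J x ^ 2)
          + ennreal (G3 x) * ennreal (J x ^ (k + 2))"
        using G[OF True] J[OF True] by (simp add: ennreal_plus ennreal_mult indicator_def)
      finally show ?thesis using True by simp
    qed simp
  qed
  also have "\<dots> = (\<integral>\<^sup>+x. indicator T x * ennreal (G0 x) \<partial>M)
        + (\<integral>\<^sup>+x. (indicator T x * ennreal (G1 x)) * indicator U x \<partial>M)
        + (\<integral>\<^sup>+x. (indicator T x * ennreal (G2 x)) * ennreal (J x ^ 2) \<partial>M)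
        + (\<integral>\<^sup>+x. (indicator T x * ennreal (G3 x)) * ennreal (J x ^ (k + 2)) \<partial>M)"
    by (simp add: nn_integral_add)
  also have "\<dots> \<le> (\<integral>\<^sup>+x. indicator T x * ennreal (G0 x) \<partial>M)
        + (\<integral>\<^sup>+x. (indicator T x * ennreal (G1 x)) * ennreal (\<delta> (r x)) \<partial>M)
        + (\<integral>\<^sup>+x. (indicator T x * ennreal (G2 x)) * ennreal mq \<partial>M)
        + (\<integral>\<^sup>+x. (indicator T x * ennreal (G3 x)) * ennreal mk \<partial>M)"
  proof (intro add_mono order_refl nn_integral_mult_le_cond_bound)
    show "AE x in M. indicator T x * ennreal (G1 x) * nn_cond_exp M F (indicator U) x
        \<le> indicator T x * ennreal (G1 x) * ennreal (\<delta> (r x))"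
      using cond_U by eventually_elim (auto intro: mult_left_mono split: split_indicator)
    show "AE x in M. indicator T x * ennreal (G2 x) * nn_cond_exp M F (\<lambda>x. ennreal (J x ^ 2)) x
        \<le> indicator T x * ennreal (G2 x) * ennreal mq"
      using cond_2 by eventually_elim (auto intro: mult_left_mono split: split_indicator)
    show "AE x in M. indicator T x * ennreal (G3 x) * nn_cond_exp M F (\<lambda>x. ennreal (J x ^ (k + 2))) x
        \<le> indicator T x * ennreal (G3 x) * ennreal mk"
      using cond_k by eventually_elim (auto intro: mult_left_mono split: split_indicator)
  qed measurable
  also have "\<dots> = (\<integral>\<^sup>+x. indicator T x * ennreal (G0 x) + (indicator T x * ennreal (G1 x)) * ennreal (\<delta> (r x))
        + (indicator T x * ennreal (G2 x)) * ennreal mq + (indicator T x * ennreal (G3 x)) * ennreal mk \<partial>M)"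
    by (simp add: nn_integral_add)
  also have "\<dots> \<le> (\<integral>\<^sup>+x. indicator T x * ennreal (Z x ^ (k + 2)) \<partial>M)"
  proof (rule nn_integral_mono)
    fix x assume "x \<in> space M"
    show "indicator T x * ennreal (G0 x) + (indicator T x * ennreal (G1 x)) * ennreal (\<delta> (r x))
        + (indicator T x * ennreal (G2 x)) * ennreal mq + (indicator T x * ennreal (G3 x)) * ennreal mk
        \<le> indicator T x * ennreal (Z x ^ (k + 2))"
    proof (cases "x \<in> T")
      case True
      let ?K = "real (k + 2)" and ?z = "Z x" and ?i = "r x"
      have "2 ^ (k + 2) * ((1 + A) ^ (k + 2) + mk) \<le> ?K * \<gamma> * ?z"
        using mult_left_mono[OF Z[OF True], of "?K * \<gamma>"] \<gamma> by (intro order_trans[OF L(3)]) simp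
      then have "(2 ^ (k + 2) * ((1 + A) ^ (k + 2) + mk)) * ?z ^ k \<le> (?K * \<gamma> * ?z) * ?z ^ k"
        using ZT[OF True] by (intro mult_right_mono) auto
      moreover have "(?K * ?z ^ (k + 1)) * ((d ?i + e ?i + 1 / s ?i) * \<delta> ?i + s ?i * mq + \<gamma>)
          \<le> (?K * ?z ^ (k + 1)) * d ?i"
        using ZT[OF True] gain by (intro mult_left_mono) auto
      ultimately have "G0 x + G1 x * \<delta> ?i + G2 x * mq + G3 x * mk \<le> ?z ^ (k + 2)"
        unfolding G0_def G1_def G2_def G3_def by (simp add: algebra_simps)
      then have "ennreal (G0 x + G1 x * \<delta> ?i + G2 x * mq + G3 x * mk) \<le> ennreal (?z ^ (k + 2))"
        by (rule ennreal_leI)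
      moreover have "ennreal (G0 x + G1 x * \<delta> ?i + G2 x * mq + G3 x * mk)
        = ennreal (G0 x) + ennreal (G1 x) * ennreal (\<delta> ?i) + ennreal (G2 x) * ennreal mq + ennreal (G3 x) * ennreal mk"
        using G[OF True] \<delta> m by (simp add: ennreal_plus ennreal_mult)
      ultimately show ?thesis using True by simp
    qed simp
  qed
  finally show ?thesis .
qed

section \<open>Moments of a hitting time from its truncations\<close>

lemma truncated_time_Suc:
  "the_enat (min (enat (Suc n)) t) = (if enat n < t then Suc n else the_enat (min (enat n) t))"
  by (cases t) (auto simp: min_def)

lemma truncated_time_le: "the_enat (min (enat n) t) \<le> n"
  by (cases t) (auto simp: min_def)

lemma truncated_time_measurable:
  fixes \<tau> :: "'a \<Rightarrow> enat"
  assumes [measurable]: "\<And>n. {x \<in> space M. enat n < \<tau> x} \<in> sets M"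
  shows "(\<lambda>x. the_enat (min (enat n) (\<tau> x))) \<in> measurable M (count_space UNIV)"
proof (induction n)
  case 0
  have "(\<lambda>x. the_enat (min (enat 0) (\<tau> x))) = (\<lambda>x. 0)" using truncated_time_le[of 0] by auto
  then show ?case by simp
next
  case (Suc n)
  note [measurable] = Suc
  have "Measurable.pred M (\<lambda>x. enat n < \<tau> x)" by (simp add: pred_def)
  then show ?case unfolding truncated_time_Suc by measurable
qed

text \<open>Optional stopping without stopped processes. The integral of the \<open>k\<close>th power of \<open>Z n\<close> over the event that \<open>\<tau>\<close> exceeds \<open>n\<close>,
plus that of the frozen quantity \<open>\<gamma> * min n \<tau>\<close> to the power \<open>k\<close> over its complement, is
non-increasing in \<open>n\<close>: on the part of the space that stops at time \<open>n + 1\<close> the value \<open>Z (n + 1)\<close> is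
replaced by the smaller \<open>\<gamma> * (n + 1)\<close>.\<close>

lemma truncated_time_moment:
  fixes \<tau> :: "'a \<Rightarrow> enat" and Z :: "nat \<Rightarrow> 'a \<Rightarrow> real"
  assumes T: "\<And>n. {x \<in> space M. enat n < \<tau> x} \<in> sets M"
    and [measurable]: "\<And>n. Z n \<in> borel_measurable M"
    and Z: "\<And>n x. \<gamma> * real n \<le> Z n x" and \<gamma>: "0 \<le> \<gamma>"
    and super: "\<And>n. (\<integral>\<^sup>+x. indicator {x \<in> space M. enat n < \<tau> x} x * ennreal (Z (Suc n) x ^ k) \<partial>M)
        \<le> (\<integral>\<^sup>+x. indicator {x \<in> space M. enat n < \<tau> x} x * ennreal (Z n x ^ k) \<partial>M)"
    and k: "0 < k"
  shows "(\<integral>\<^sup>+x. ennreal ((\<gamma> * real (the_enat (min (enat n) (\<tau> x)))) ^ k) \<partial>M) \<le> (\<integral>\<^sup>+x. ennreal (Z 0 x ^ k) \<partial>M)"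
proof -
  define T where "T n = {x \<in> space M. enat n < \<tau> x}" for n
  have [measurable]: "T n \<in> sets M" for n using T by (simp add: T_def)
  define \<sigma> where "\<sigma> n x = the_enat (min (enat n) (\<tau> x))" for n x
  have \<sigma>_Suc: "\<sigma> (Suc n) x = (if x \<in> T n then Suc n else \<sigma> n x)" if "x \<in> space M" for n x
    using that by (simp add: \<sigma>_def T_def truncated_time_Suc)
  have \<sigma>_le: "\<sigma> n x \<le> n" for n x by (simp add: \<sigma>_def truncated_time_le)
  have [measurable]: "\<sigma> n \<in> measurable M (count_space UNIV)" for n
    unfolding \<sigma>_def by (rule truncated_time_measurable[OF T])
  define stopped where "stopped n x = indicator (T n) x * ennreal (Z n x ^ k)
      + indicator (space M - T n) x * ennreal ((\<gamma> * real (\<sigma> n x)) ^ k)" for n x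
  have mono: "ennreal ((\<gamma> * real i) ^ k) \<le> ennreal (Z n x ^ k)" if "i \<le> n" for i n x
  proof (rule ennreal_leI, rule power_mono)
    show "\<gamma> * real i \<le> Z n x" using Z[of n x] mult_left_mono[of "real i" "real n" \<gamma>] that \<gamma> by auto
  qed (use \<gamma> in auto)
  have step: "(\<integral>\<^sup>+x. stopped (Suc n) x \<partial>M) \<le> (\<integral>\<^sup>+x. stopped n x \<partial>M)" for n
  proof -
    have sub: "T (Suc n) \<subseteq> T n" by (auto simp: T_def) (metis Suc_ile_eq order_less_imp_le)
    have "(\<integral>\<^sup>+x. stopped (Suc n) x \<partial>M) \<le> (\<integral>\<^sup>+x. indicator (T n) x * ennreal (Z (Suc n) x ^ k)
      + indicator (space M - T n) x * ennreal ((\<gamma> * real (\<sigma> n x)) ^ k) \<partial>M)"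
    proof (rule nn_integral_mono)
      fix x assume x: "x \<in> space M"
      show "stopped (Suc n) x \<le> indicator (T n) x * ennreal (Z (Suc n) x ^ k)
      + indicator (space M - T n) x * ennreal ((\<gamma> * real (\<sigma> n x)) ^ k)"
        using sub mono[of "Suc n" "Suc n" x]
        by (auto simp: stopped_def \<sigma>_Suc[OF x] indicator_def x)
    qed
    also have "\<dots> = (\<integral>\<^sup>+x. indicator (T n) x * ennreal (Z (Suc n) x ^ k) \<partial>M)
      + (\<integral>\<^sup>+x. indicator (space M - T n) x * ennreal ((\<gamma> * real (\<sigma> n x)) ^ k) \<partial>M)"
      by (rule nn_integral_add) measurable
    also have "\<dots> \<le> (\<integral>\<^sup>+x. indicator (T n) x * ennreal (Z n x ^ k) \<partial>M)
      + (\<integral>\<^sup>+x. indicator (space M - T n) x * ennreal ((\<gamma> * real (\<sigma> n x)) ^ k) \<partial>M)"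
      using super[of n] unfolding T_def by (intro add_mono) auto
    also have "\<dots> = (\<integral>\<^sup>+x. stopped n x \<partial>M)"
      unfolding stopped_def by (rule nn_integral_add[symmetric]) measurable
    finally show ?thesis .
  qed
  have "(\<integral>\<^sup>+x. ennreal ((\<gamma> * real (\<sigma> n x)) ^ k) \<partial>M) \<le> (\<integral>\<^sup>+x. stopped n x \<partial>M)"
    by (rule nn_integral_mono) (use mono[OF \<sigma>_le] in \<open>auto simp: stopped_def indicator_def\<close>)
  also have "\<dots> \<le> (\<integral>\<^sup>+x. stopped 0 x \<partial>M)"
    by (induction n) (auto intro: order_trans[OF step])
  also have "\<dots> \<le> (\<integral>\<^sup>+x. ennreal (Z 0 x ^ k) \<partial>M)"
    by (rule nn_integral_mono) (use \<sigma>_le[of 0] k in \<open>auto simp: stopped_def indicator_def zero_power\<close>)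
  finally show ?thesis unfolding \<sigma>_def .
qed

lemma enat_powr_eq_SUP_truncated:
  assumes "0 < p"
  shows "enat_powr t p = (SUP n. ennreal (real (the_enat (min (enat n) t)) powr p))"
proof (cases t)
  case (enat k)
  show ?thesis
  proof (rule antisym)
    show "enat_powr t p \<le> (SUP n. ennreal (real (the_enat (min (enat n) t)) powr p))"
      by (rule SUP_upper2[of k]) (auto simp: enat enat_powr_def)
    show "(SUP n. ennreal (real (the_enat (min (enat n) t)) powr p)) \<le> enat_powr t p"
      using assms by (intro SUP_least) (auto simp: enat enat_powr_def min_def intro!: ennreal_leI powr_mono2)
  qed
next
  case infinity
  have "filterlim (\<lambda>n. real n powr p) at_top sequentially" using assms by real_asymp
  then have "(\<lambda>n. ennreal (real n powr p)) \<longlonglongrightarrow> \<infinity>"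
    by (rule ennreal_tendsto_top_eq_at_top[THEN iffD2, folded infinity_ennreal_def])
  moreover have "(\<lambda>n. ennreal (real n powr p)) \<longlonglongrightarrow> (SUP n. ennreal (real n powr p))"
    using assms by (intro LIMSEQ_SUP monoI) (simp add: ennreal_leI powr_mono2)
  ultimately have sup: "(SUP n. ennreal (real n powr p)) = \<infinity>"
    by (rule LIMSEQ_unique[symmetric])
  have trunc: "the_enat (min (enat n) t) = n" for n by (simp add: infinity)
  show ?thesis unfolding trunc sup by (simp add: infinity enat_powr_def)
qed

text \<open>A moment of integer order \<open>K\<close> at scale \<open>s\<close> controls the moments of real order \<open>p \<le> K\<close> at the same
scale, since \<open>t powr p\<close> is at most \<open>s powr p\<close> for \<open>t \<le> s\<close>, and at most \<open>s powr p\<close> times the \<open>K\<close>th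
power of \<open>t / s\<close> otherwise.\<close>

lemma moment_of_truncated_moments:
  fixes \<tau> :: "'a \<Rightarrow> enat" and s \<gamma> p :: real
  assumes "prob_space M" and T: "\<And>n. {x \<in> space M. enat n < \<tau> x} \<in> sets M"
    and s: "0 < s" and \<gamma>: "0 < \<gamma>" and p: "0 < p" "p \<le> real K" "0 < K"
    and trunc: "\<And>n. (\<integral>\<^sup>+x. ennreal ((\<gamma> * real (the_enat (min (enat n) (\<tau> x)))) ^ K) \<partial>M) \<le> ennreal (s ^ K)"
  shows "(\<integral>\<^sup>+x. enat_powr (\<tau> x) p \<partial>M) \<le> ennreal (s powr p * (1 + 1 / \<gamma> ^ K))"
proof -
  interpret prob_space M by fact
  define \<sigma> where "\<sigma> n x = the_enat (min (enat n) (\<tau> x))" for n x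
  have [measurable]: "\<sigma> n \<in> measurable M (count_space UNIV)" for n
    unfolding \<sigma>_def by (rule truncated_time_measurable[OF T])
  have pointwise: "t powr p \<le> s powr p + s powr p / (\<gamma> * s) ^ K * (\<gamma> * t) ^ K" if t: "0 \<le> t" for t
  proof (cases "t \<le> s")
    case True
    then have "t powr p \<le> s powr p" using t p by (intro powr_mono2) auto
    moreover have "0 \<le> s powr p / (\<gamma> * s) ^ K * (\<gamma> * t) ^ K" using s \<gamma> t by simp
    ultimately show ?thesis by linarith
  next
    case False
    then have "(t / s) powr p \<le> (t / s) powr real K" using s p by (intro powr_mono) auto
    also have "\<dots> = (t / s) ^ K" using False s by (intro powr_realpow) auto
    finally have "s powr p * (t / s) powr p \<le> s powr p * (t / s) ^ K" by (intro mult_left_mono) auto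
    moreover have "s powr p * (t / s) powr p = t powr p"
      using s t by (simp add: powr_divide)
    moreover have "s powr p * (t / s) ^ K = s powr p / (\<gamma> * s) ^ K * (\<gamma> * t) ^ K"
      using s \<gamma> by (simp add: power_mult_distrib power_divide)
    moreover have "0 \<le> s powr p" by simp
    ultimately show ?thesis by linarith
  qed
  have bound: "(\<integral>\<^sup>+x. ennreal (real (\<sigma> n x) powr p) \<partial>M) \<le> ennreal (s powr p * (1 + 1 / \<gamma> ^ K))" for n
  proof -
    let ?c = "s powr p / (\<gamma> * s) ^ K"
    have c: "0 \<le> ?c" using s \<gamma> by simp
    have "(\<integral>\<^sup>+x. ennreal (real (\<sigma> n x) powr p) \<partial>M)
        \<le> (\<integral>\<^sup>+x. ennreal (s powr p) + ennreal ?c * ennreal ((\<gamma> * real (\<sigma> n x)) ^ K) \<partial>M)"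
    proof (rule nn_integral_mono)
      fix x
      have "ennreal (real (\<sigma> n x) powr p) \<le> ennreal (s powr p + ?c * (\<gamma> * real (\<sigma> n x)) ^ K)"
        using pointwise[of "real (\<sigma> n x)"] by (intro ennreal_leI) simp
      also have "\<dots> = ennreal (s powr p) + ennreal ?c * ennreal ((\<gamma> * real (\<sigma> n x)) ^ K)"
        using c \<gamma> by (subst ennreal_plus) (simp_all add: ennreal_mult del: times_divide_eq_left)
      finally show "ennreal (real (\<sigma> n x) powr p)
          \<le> ennreal (s powr p) + ennreal ?c * ennreal ((\<gamma> * real (\<sigma> n x)) ^ K)" .
    qed
    also have "\<dots> = ennreal (s powr p) + ennreal ?c * (\<integral>\<^sup>+x. ennreal ((\<gamma> * real (\<sigma> n x)) ^ K) \<partial>M)"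
      by (subst nn_integral_add) (simp_all add: nn_integral_cmult emeasure_space_1)
    also have "\<dots> \<le> ennreal (s powr p) + ennreal ?c * ennreal (s ^ K)"
      using trunc[of n] unfolding \<sigma>_def by (intro add_left_mono mult_left_mono) auto
    also have "\<dots> = ennreal (s powr p + ?c * s ^ K)"
      using c s by (subst ennreal_plus) (simp_all add: ennreal_mult del: times_divide_eq_left)
    also have "s powr p + ?c * s ^ K = s powr p * (1 + 1 / \<gamma> ^ K)"
      using s \<gamma> by (simp add: power_mult_distrib field_simps)
    finally show ?thesis .
  qed
  have inc: "incseq (\<lambda>n x. ennreal (real (\<sigma> n x) powr p))"
  proof (intro incseq_SucI le_funI ennreal_leI)
    fix n x
    have "\<sigma> n x \<le> \<sigma> (Suc n) x" by (simp add: \<sigma>_def truncated_time_Suc truncated_time_le le_SucI)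
    then show "real (\<sigma> n x) powr p \<le> real (\<sigma> (Suc n) x) powr p"
      using p by (intro powr_mono2) auto
  qed
  have "(\<integral>\<^sup>+x. enat_powr (\<tau> x) p \<partial>M) = (\<integral>\<^sup>+x. (SUP n. ennreal (real (\<sigma> n x) powr p)) \<partial>M)"
    using p by (simp add: enat_powr_eq_SUP_truncated \<sigma>_def)
  also have "\<dots> = (SUP n. \<integral>\<^sup>+x. ennreal (real (\<sigma> n x) powr p) \<partial>M)"
    by (rule nn_integral_monotone_convergence_SUP[OF inc]) measurable
  also have "\<dots> \<le> ennreal (s powr p * (1 + 1 / \<gamma> ^ K))" by (rule SUP_least) (rule bound)
  finally show ?thesis .
qed

lemma enat_less_hitting_time_iff: "enat n < hitting_time X N x \<longleftrightarrow> (\<forall>i\<le>n. N < X i x)"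
proof -
  have "hitting_time X N x \<le> enat n \<longleftrightarrow> (\<exists>i\<le>n. X i x \<le> N)"
  proof
    assume le: "hitting_time X N x \<le> enat n"
    have "enat ` {t. X t x \<le> N} \<noteq> {}"
    proof
      assume "enat ` {t. X t x \<le> N} = {}"
      then have "hitting_time X N x = \<infinity>" unfolding hitting_time_def by (simp add: top_enat_def)
      with le show False by simp
    qed
    then have "hitting_time X N x \<in> enat ` {t. X t x \<le> N}"
      unfolding hitting_time_def Inf_enat_def by (auto intro: LeastI)
    with le show "\<exists>i\<le>n. X i x \<le> N" by auto
  next
    assume "\<exists>i\<le>n. X i x \<le> N"
    then obtain i where "i \<le> n" "X i x \<le> N" by blast
    then have "hitting_time X N x \<le> enat i" unfolding hitting_time_def by (intro Inf_lower) auto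
    with \<open>i \<le> n\<close> show "hitting_time X N x \<le> enat n" by (meson enat_ord_simps(1) order_trans)
  qed
  then show ?thesis by (metis linorder_not_less)
qed

section \<open>Runs of decrease and the memory of the process\<close>

lemma generated_algebra_measurable:
  assumes "Z \<in> Zs"
  shows "Z \<in> measurable (generated_algebra \<Omega> Zs) (count_space UNIV)"
proof (rule measurableI)
  fix A :: "nat set"
  have "Z -` A \<inter> space \<Omega> \<in> {Z -` A \<inter> space \<Omega> | Z A. Z \<in> Zs}" using assms by blast
  then have "Z -` A \<inter> space \<Omega> \<in> sigma_sets (space \<Omega>) {Z -` A \<inter> space \<Omega> | Z A. Z \<in> Zs}"
    by (rule sigma_sets.Basic)
  moreover have "{Z -` A \<inter> space \<Omega> | Z A. Z \<in> Zs} \<subseteq> Pow (space \<Omega>)" by blast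
  ultimately show "Z -` A \<inter> space (generated_algebra \<Omega> Zs) \<in> sets (generated_algebra \<Omega> Zs)"
    unfolding generated_algebra_def by (simp only: sets_measure_of space_measure_of_conv)
qed simp

lemma generated_algebra_least:
  assumes "space \<Omega> = space M" "\<And>Z. Z \<in> Zs \<Longrightarrow> Z \<in> measurable M (count_space UNIV)"
  shows "subalgebra M (generated_algebra \<Omega> Zs)"
proof -
  have "{Z -` A \<inter> space \<Omega> | Z A. Z \<in> Zs} \<subseteq> sets M"
    using measurable_sets[OF assms(2)] assms(1) by auto
  then have "sigma_sets (space M) {Z -` A \<inter> space \<Omega> | Z A. Z \<in> Zs} \<subseteq> sets M"
    by (rule sets.sigma_sets_subset)
  moreover have "{Z -` A \<inter> space \<Omega> | Z A. Z \<in> Zs} \<subseteq> Pow (space \<Omega>)" by blast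
  ultimately show ?thesis
    unfolding subalgebra_def generated_algebra_def
    by (simp only: sets_measure_of space_measure_of_conv assms(1) simp_thms)
qed

lemma space_generated_algebra: "space (generated_algebra \<Omega> Zs) = space \<Omega>"
  by (simp add: generated_algebra_def space_measure_of_conv)

lemma run_start_props:
  shows run_start_le: "run_start X n x \<le> n"
    and run_start_decreasing: "run_start X n x \<le> i \<Longrightarrow> i < n \<Longrightarrow> X (Suc i) x < X i x"
    and run_start_leI: "k \<le> n \<Longrightarrow> (\<And>i. k \<le> i \<Longrightarrow> i < n \<Longrightarrow> X (Suc i) x < X i x) \<Longrightarrow> run_start X n x \<le> k"
proof -
  let ?K = "{k. k \<le> n \<and> (\<forall>i\<in>{k..<n}. X (Suc i) x < X i x)}"
  have "n \<in> ?K" by simp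
  then have "Inf ?K \<in> ?K" by (intro Inf_nat_def1) blast
  then have "run_start X n x \<in> ?K" by (simp only: run_start_def)
  then show "run_start X n x \<le> n" "run_start X n x \<le> i \<Longrightarrow> i < n \<Longrightarrow> X (Suc i) x < X i x"
    by auto
  show "k \<le> n \<Longrightarrow> (\<And>i. k \<le> i \<Longrightarrow> i < n \<Longrightarrow> X (Suc i) x < X i x) \<Longrightarrow> run_start X n x \<le> k"
    unfolding run_start_def by (intro cInf_lower) auto
qed

text \<open>A decreasing step prolongs the current run, so the run length grows by at least one.\<close>

lemma run_start_Suc_le:
  assumes "X (Suc n) x < X n x"
  shows "run_start X (Suc n) x \<le> run_start X n x"
proof (rule run_start_leI)
  show "run_start X n x \<le> Suc n" using run_start_le[of X n x] by simp
  show "X (Suc i) x < X i x" if "run_start X n x \<le> i" "i < Suc n" for i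
    using that assms run_start_decreasing[of X n x i] by (cases "i = n") auto
qed

lemma run_start_measurable:
  assumes X: "\<And>i. i \<le> n \<Longrightarrow> X i \<in> measurable M (count_space UNIV)"
  shows "run_start X n \<in> measurable M (count_space UNIV)"
proof -
  \<comment> \<open>A sequence that is measurable at all times and agrees with \<open>X\<close> up to \<open>n\<close>.\<close>
  define Y where "Y k x = (if k \<le> n then X k x else 0)" for k x
  have Y: "Y k \<in> measurable M (count_space UNIV)" for k
    unfolding Y_def by (cases "k \<le> n") (simp_all add: X)
  have Y' [measurable]: "Y k \<in> borel_measurable M" for k
    by (rule measurable_compose[OF Y]) simp
  have "(\<lambda>x. LEAST k. k \<le> n \<and> (\<forall>i\<in>{k..<n}. Y (Suc i) x < Y i x)) \<in> measurable M (count_space UNIV)"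
    by measurable
  also have "(\<lambda>x. LEAST k. k \<le> n \<and> (\<forall>i\<in>{k..<n}. Y (Suc i) x < Y i x)) = run_start X n"
    unfolding run_start_def Inf_nat_def Y_def mem_Collect_eq
    by (intro ext arg_cong[where f = Least]) auto
  finally show ?thesis .
qed

lemma natural_algebra_measurable:
  "i \<le> n \<Longrightarrow> X i \<in> measurable (natural_algebra \<Omega> X n) (count_space UNIV)"
  unfolding natural_algebra_def by (intro generated_algebra_measurable) auto

lemma natural_algebra_subalgebra:
  assumes "space \<Omega> = space M" "\<And>i. X i \<in> measurable M (count_space UNIV)"
  shows "subalgebra M (natural_algebra \<Omega> X n)"
  unfolding natural_algebra_def using assms by (intro generated_algebra_least) auto

lemma run_start_natural_measurable:
  "run_start X n \<in> measurable (natural_algebra \<Omega> X n) (count_space UNIV)"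
  by (intro run_start_measurable natural_algebra_measurable)

lemma memory_algebra_subalgebra: "subalgebra (natural_algebra \<Omega> X n) (memory_algebra \<Omega> X n)"
  unfolding memory_algebra_def
proof (rule generated_algebra_least)
  show "space \<Omega> = space (natural_algebra \<Omega> X n)"
    by (simp add: natural_algebra_def space_generated_algebra)
  fix Z assume "Z \<in> insert (run_start X n) ((\<lambda>i. run_value X i n) ` {..n})"
  then consider "Z = run_start X n" | i where "i \<le> n" "Z = run_value X i n" by auto
  then show "Z \<in> measurable (natural_algebra \<Omega> X n) (count_space UNIV)"
  proof cases
    case 2
    note [measurable] = run_start_natural_measurable natural_algebra_measurable[OF 2(1)]
    show ?thesis unfolding 2(2) run_value_def[abs_def] by measurable
  qed (simp add: run_start_natural_measurable)
qed

text \<open>The memory contains the present state, since the current run always includes the time \<open>n\<close>.\<close>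

lemma current_state_memory_measurable: "X n \<in> measurable (memory_algebra \<Omega> X n) (count_space UNIV)"
proof -
  have "run_value X n n = X n" by (auto simp: run_value_def run_start_le)
  moreover have "run_value X n n \<in> measurable (memory_algebra \<Omega> X n) (count_space UNIV)"
    unfolding memory_algebra_def by (rule generated_algebra_measurable) auto
  ultimately show ?thesis by simp
qed

lemma process_with_lawsD:
  assumes "process_with_laws S \<Omega> P X" "x \<in> S"
  shows "prob_space (P x)" "space (P x) = space \<Omega>" "X n \<in> measurable (P x) (count_space UNIV)"
    "AE \<omega> in P x. X 0 \<omega> = x" "subalgebra (P x) (natural_algebra \<Omega> X n)"
    "subalgebra (P x) (memory_algebra \<Omega> X n)"
proof -
  have sets: "sets (P x) = sets \<Omega>" using assms by (auto simp: process_with_laws_def)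
  show space: "space (P x) = space \<Omega>" using sets by (rule sets_eq_imp_space_eq)
  show meas: "X n \<in> measurable (P x) (count_space UNIV)" for n
  proof -
    have "X n \<in> measurable \<Omega> (count_space S)" using assms by (auto simp: process_with_laws_def)
    then have "X n \<in> measurable \<Omega> (count_space UNIV)"
      by (rule measurable_compose[where g = "\<lambda>i. i"]) simp
    then show ?thesis by (simp only: measurable_cong_sets[OF sets refl])
  qed
  show "prob_space (P x)" "AE \<omega> in P x. X 0 \<omega> = x" using assms by (auto simp: process_with_laws_def)
  show nat: "subalgebra (P x) (natural_algebra \<Omega> X n)" for n
    by (rule natural_algebra_subalgebra) (simp_all add: space meas)
  show "subalgebra (P x) (memory_algebra \<Omega> X n)"
    using nat[of n] memory_algebra_subalgebra[of \<Omega> X n] by (auto simp: subalgebra_def)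
qed

section \<open>Conditional laws given the past\<close>

text \<open>If conditioning on \<open>F\<close> and on the smaller \<open>G\<close> gives the same probabilities to all values of \<open>Y'\<close>,
the same is true of every function of \<open>Y'\<close> and a \<open>G\<close>-measurable \<open>Y\<close>: splitting according to the
values of \<open>Y'\<close> yields a single function \<open>Q\<close> that is a version of both conditional expectations.\<close>

lemma nn_cond_exp_countable_decomposition:
  fixes Y Y' :: "'a \<Rightarrow> nat" and h :: "nat \<Rightarrow> nat \<Rightarrow> ennreal"
  assumes "prob_space M" "subalgebra M F" "subalgebra F G"
    and Y: "Y \<in> measurable G (count_space UNIV)"
    and Y' [measurable]: "Y' \<in> measurable M (count_space UNIV)"
    and eq: "\<And>j. AE x in M. nn_cond_exp M F (indicator {x \<in> space M. Y' x = j}) x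
       = nn_cond_exp M G (indicator {x \<in> space M. Y' x = j}) x"
  shows "AE x in M. nn_cond_exp M F (\<lambda>x. h (Y x) (Y' x)) x = nn_cond_exp M G (\<lambda>x. h (Y x) (Y' x)) x"
proof -
  interpret prob_space M by fact
  have MG: "subalgebra M G" using assms by (auto simp: subalgebra_def)
  interpret F: finite_measure_subalgebra M F by unfold_locales fact
  interpret G: finite_measure_subalgebra M G by unfold_locales fact
  have YF: "Y \<in> measurable F (count_space UNIV)" by (rule measurable_from_subalg[OF assms(3) Y])
  have [measurable]: "Y \<in> measurable M (count_space UNIV)" by (rule measurable_from_subalg[OF MG Y])
  define I where "I j = (indicator {x \<in> space M. Y' x = j} :: 'a \<Rightarrow> ennreal)" for j
  have [measurable]: "I j \<in> borel_measurable M" for j unfolding I_def by measurable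
  have expand: "h (Y x) (Y' x) = (\<Sum>j. h (Y x) j * I j x)" if "x \<in> space M" for x
  proof -
    have "(\<Sum>j. h (Y x) j * I j x) = (\<Sum>j\<in>{Y' x}. h (Y x) j * I j x)"
      by (rule suminf_finite) (auto simp: I_def)
    then show ?thesis using that by (simp add: I_def)
  qed
  define Q where "Q x = (\<Sum>j. h (Y x) j * nn_cond_exp M G (I j) x)" for x
  have char: "AE x in M. Q x = nn_cond_exp M H (\<lambda>x. h (Y x) (Y' x)) x"
    if H: "sigma_finite_subalgebra M H" and YH [measurable]: "Y \<in> measurable H (count_space UNIV)"
      and QH: "Q \<in> borel_measurable H"
      and eqH: "\<And>j. AE x in M. nn_cond_exp M H (I j) x = nn_cond_exp M G (I j) x" for H
  proof (rule sigma_finite_subalgebra.nn_cond_exp_charact[OF H])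
    interpret H: sigma_finite_subalgebra M H by fact
    fix A assume A [measurable]: "A \<in> sets H"
    then have [measurable]: "A \<in> sets M" using H.subalg by (auto simp: subalgebra_def)
    have "(\<integral>\<^sup>+x\<in>A. h (Y x) (Y' x) \<partial>M) = (\<integral>\<^sup>+x. (\<Sum>j. (indicator A x * h (Y x) j) * I j x) \<partial>M)"
      by (intro nn_integral_cong) (simp only: expand mult.assoc ennreal_suminf_cmult mult.commute[of "suminf _"])
    also have "\<dots> = (\<Sum>j. \<integral>\<^sup>+x. (indicator A x * h (Y x) j) * I j x \<partial>M)"
      by (rule nn_integral_suminf) measurable
    also have "\<dots> = (\<Sum>j. \<integral>\<^sup>+x. (indicator A x * h (Y x) j) * nn_cond_exp M H (I j) x \<partial>M)"
      by (subst H.nn_cond_exp_intg) measurable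
    also have "\<dots> = (\<Sum>j. \<integral>\<^sup>+x. (indicator A x * h (Y x) j) * nn_cond_exp M G (I j) x \<partial>M)"
    proof (intro suminf_cong nn_integral_cong_AE)
      fix j
      show "AE x in M. indicator A x * h (Y x) j * nn_cond_exp M H (I j) x
          = indicator A x * h (Y x) j * nn_cond_exp M G (I j) x"
        using eqH[of j] by eventually_elim simp
    qed
    also have "\<dots> = (\<integral>\<^sup>+x. (\<Sum>j. (indicator A x * h (Y x) j) * nn_cond_exp M G (I j) x) \<partial>M)"
      by (rule nn_integral_suminf[symmetric]) measurable
    also have "\<dots> = (\<integral>\<^sup>+x\<in>A. Q x \<partial>M)"
      by (intro nn_integral_cong) (simp only: Q_def mult.assoc ennreal_suminf_cmult mult.commute[of "suminf _"])
    finally show "(\<integral>\<^sup>+x\<in>A. h (Y x) (Y' x) \<partial>M) = (\<integral>\<^sup>+x\<in>A. Q x \<partial>M)" .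
  qed (use QH in \<open>measurable\<close>)
  have QG: "Q \<in> borel_measurable G" unfolding Q_def using Y by measurable
  have "AE x in M. Q x = nn_cond_exp M F (\<lambda>x. h (Y x) (Y' x)) x"
    by (rule char[OF F.sigma_finite_subalgebra_axioms YF measurable_from_subalg[OF assms(3) QG]])
       (use eq in \<open>simp add: I_def\<close>)
  moreover have "AE x in M. Q x = nn_cond_exp M G (\<lambda>x. h (Y x) (Y' x)) x"
    by (rule char[OF G.sigma_finite_subalgebra_axioms Y QG]) simp
  ultimately show ?thesis by eventually_elim simp
qed

text \<open>The use that is made of the random memory depth. The function \<open>f\<close> is prescribed only on the space,
so that indicators of subsets of the space are covered.\<close>

lemma cond_exp_natural_eq_memory:
  assumes proc: "process_with_laws S \<Omega> P X" "x \<in> S" and depth: "random_memory_depth S \<Omega> P X"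
    and f: "\<And>\<omega>. \<omega> \<in> space \<Omega> \<Longrightarrow> f \<omega> = h (X n \<omega>) (X (Suc n) \<omega>)"
  shows "AE \<omega> in P x. nn_cond_exp (P x) (natural_algebra \<Omega> X n) f \<omega>
     = nn_cond_exp (P x) (memory_algebra \<Omega> X n) f \<omega>"
proof -
  note proc' = process_with_lawsD[OF proc]
  interpret prob_space "P x" by (rule proc')
  interpret nat: finite_measure_subalgebra "P x" "natural_algebra \<Omega> X n" by unfold_locales (rule proc')
  interpret mem: finite_measure_subalgebra "P x" "memory_algebra \<Omega> X n" by unfold_locales (rule proc')
  note [measurable] = proc'(3)
  have A [measurable]: "{\<omega> \<in> space \<Omega>. X (Suc n) \<omega> = j} \<in> sets (P x)" for j
    unfolding proc'(2)[symmetric] by measurable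
  have "AE \<omega> in P x. nn_cond_exp (P x) (natural_algebra \<Omega> X n) (indicator {\<omega> \<in> space \<Omega>. X (Suc n) \<omega> = j}) \<omega>
       = nn_cond_exp (P x) (memory_algebra \<Omega> X n) (indicator {\<omega> \<in> space \<Omega>. X (Suc n) \<omega> = j}) \<omega>" for j
  proof (cases "j \<in> S")
    case True
    then have "AE \<omega> in P x. real_cond_exp (P x) (natural_algebra \<Omega> X n) (indicator {\<omega> \<in> space \<Omega>. X (Suc n) \<omega> = j}) \<omega>
       = real_cond_exp (P x) (memory_algebra \<Omega> X n) (indicator {\<omega> \<in> space \<Omega>. X (Suc n) \<omega> = j}) \<omega>"
      using depth proc(2) unfolding random_memory_depth_def by blast
    with nat.nn_cond_exp_indicator[OF A[of j]] mem.nn_cond_exp_indicator[OF A[of j]]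
    show ?thesis by eventually_elim simp
  next
    \<comment> \<open>The memory condition speaks of states \<open>j \<in> S\<close> only; other values are never taken.\<close>
    case False
    have "X (Suc n) \<omega> \<in> S" if "\<omega> \<in> space \<Omega>" for \<omega>
    proof -
      have "X (Suc n) \<in> measurable \<Omega> (count_space S)" using proc(1) by (simp add: process_with_laws_def)
      from measurable_space[OF this that] show ?thesis by simp
    qed
    with False have empty: "{\<omega> \<in> space \<Omega>. X (Suc n) \<omega> = j} = {}" by auto
    have "AE \<omega> in P x. 0 = nn_cond_exp (P x) (natural_algebra \<Omega> X n) (\<lambda>_. 0) \<omega>"
      by (rule nat.nn_cond_exp_F_meas) auto
    moreover have "AE \<omega> in P x. 0 = nn_cond_exp (P x) (memory_algebra \<Omega> X n) (\<lambda>_. 0) \<omega>"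
      by (rule mem.nn_cond_exp_F_meas) auto
    moreover have zero: "indicator {} = (\<lambda>_. 0 :: ennreal)" by auto
    ultimately show ?thesis unfolding empty zero by auto
  qed
  then have *: "AE \<omega> in P x. nn_cond_exp (P x) (natural_algebra \<Omega> X n) (\<lambda>\<omega>. h (X n \<omega>) (X (Suc n) \<omega>)) \<omega>
     = nn_cond_exp (P x) (memory_algebra \<Omega> X n) (\<lambda>\<omega>. h (X n \<omega>) (X (Suc n) \<omega>)) \<omega>"
    by (intro nn_cond_exp_countable_decomposition prob_space_axioms nat.subalg memory_algebra_subalgebra
        current_state_memory_measurable proc'(3)) (simp add: proc'(2))
  have h: "(\<lambda>\<omega>. h (X n \<omega>) (X (Suc n) \<omega>)) \<in> borel_measurable (P x)" by measurable
  then have f': "f \<in> borel_measurable (P x)"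
    by (rule measurable_cong[THEN iffD2, rotated]) (simp add: f proc'(2))
  have eq: "AE \<omega> in P x. f \<omega> = h (X n \<omega>) (X (Suc n) \<omega>)"
    by (rule AE_I2) (simp add: f proc'(2))
  from * nat.nn_cond_exp_cong[OF eq f' h] mem.nn_cond_exp_cong[OF eq f' h]
  show ?thesis by eventually_elim simp
qed

text \<open>Recurrence is assumed for runs of a given length; splitting over the countably many values of the
actual run length gives the bound with a random index.\<close>

lemma cond_prob_not_decreasing_le:
  assumes proc: "process_with_laws S \<Omega> P X" "x \<in> S" and depth: "random_memory_depth S \<Omega> P X"
    and rec: "recurrence1 S \<Omega> P X N \<kappa>"
  shows "AE \<omega> in P x. N < X n \<omega> \<longrightarrow>
    nn_cond_exp (P x) (natural_algebra \<Omega> X n) (indicator {\<omega> \<in> space \<Omega>. X n \<omega> \<le> X (Suc n) \<omega>}) \<omega>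
      \<le> ennreal (1 - \<kappa> (n - run_start X n \<omega>))"
proof -
  note proc' = process_with_lawsD[OF proc]
  interpret prob_space "P x" by (rule proc')
  interpret mem: finite_measure_subalgebra "P x" "memory_algebra \<Omega> X n" by unfold_locales (rule proc')
  let ?up = "{\<omega> \<in> space \<Omega>. X n \<omega> \<le> X (Suc n) \<omega>}" and ?down = "{\<omega> \<in> space \<Omega>. X (Suc n) \<omega> < X n \<omega>}"
  let ?E = "nn_cond_exp (P x) (memory_algebra \<Omega> X n)"
  have [measurable]: "X i \<in> borel_measurable (P x)" for i
    by (rule measurable_compose[OF proc'(3)]) simp
  have up [measurable]: "?up \<in> sets (P x)" and down [measurable]: "?down \<in> sets (P x)"
    unfolding proc'(2)[symmetric] by measurable
  have "AE \<omega> in P x. ?E (indicator ?up) \<omega> + ?E (indicator ?down) \<omega>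
      = ?E (\<lambda>\<omega>. indicator ?up \<omega> + indicator ?down \<omega>) \<omega>"
    by (rule mem.nn_cond_exp_sum) measurable
  moreover have "AE \<omega> in P x. ?E (\<lambda>\<omega>. indicator ?up \<omega> + indicator ?down \<omega>) \<omega> = ?E (\<lambda>_. 1) \<omega>"
  proof (rule mem.nn_cond_exp_cong)
    show "AE \<omega> in P x. (indicator ?up \<omega> + indicator ?down \<omega> :: ennreal) = 1"
      by (rule AE_I2) (auto simp: indicator_def proc'(2))
  qed measurable
  moreover have "AE \<omega> in P x. 1 = ?E (\<lambda>_. 1) \<omega>"
    by (rule mem.nn_cond_exp_F_meas) auto
  moreover note mem.nn_cond_exp_indicator[OF down]
  \<comment> \<open>The parameter \<open>k\<close> of the recurrence condition counts states, not steps: \<open>k = r + 1\<close>.\<close>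
  moreover have "AE \<omega> in P x. \<forall>r. N < X n \<omega> \<and> r \<le> n \<and> (\<forall>i\<in>{n - r..<n}. X (Suc i) \<omega> < X i \<omega>) \<longrightarrow>
        \<kappa> r \<le> real_cond_exp (P x) (memory_algebra \<Omega> X n) (indicator ?down) \<omega>"
    unfolding AE_all_countable
  proof
    fix r
    show "AE \<omega> in P x. N < X n \<omega> \<and> r \<le> n \<and> (\<forall>i\<in>{n - r..<n}. X (Suc i) \<omega> < X i \<omega>) \<longrightarrow>
        \<kappa> r \<le> real_cond_exp (P x) (memory_algebra \<Omega> X n) (indicator ?down) \<omega>"
    proof (cases "r \<le> n")
      case True
      have "AE \<omega> in P x. N < X n \<omega> \<and> (\<forall>i\<in>{n + 1 - (r + 1)..<n}. X (Suc i) \<omega> < X i \<omega>) \<longrightarrow>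
        \<kappa> (r + 1 - 1) \<le> real_cond_exp (P x) (memory_algebra \<Omega> X n) (indicator ?down) \<omega>"
      proof -
        have "AE \<omega> in P x. N < X n' \<omega> \<and> (\<forall>i\<in>{n' + 1 - k..<n'}. X (Suc i) \<omega> < X i \<omega>) \<longrightarrow>
            \<kappa> (k - 1) \<le> real_cond_exp (P x) (memory_algebra \<Omega> X n')
              (indicator {\<omega> \<in> space \<Omega>. X (Suc n') \<omega> < X n' \<omega>}) \<omega>" if "1 \<le> k" "k - 1 \<le> n'" for k n'
          using rec proc(2) that unfolding recurrence1_def by blast
        from this[of "r + 1" n] True show ?thesis by simp
      qed
      then show ?thesis by eventually_elim simp
    qed simp
  qed
  moreover have "AE \<omega> in P x. nn_cond_exp (P x) (natural_algebra \<Omega> X n) (indicator ?up) \<omega> = ?E (indicator ?up) \<omega>"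
    by (rule cond_exp_natural_eq_memory[OF proc depth, where h = "\<lambda>a b. of_bool (a \<le> b)"])
       (simp add: indicator_def)
  ultimately show ?thesis
  proof eventually_elim
    case (elim \<omega>)
    let ?r = "n - run_start X n \<omega>" and ?q = "real_cond_exp (P x) (memory_algebra \<Omega> X n) (indicator ?down) \<omega>"
    show ?case
    proof
      assume "N < X n \<omega>"
      then have "\<kappa> ?r \<le> ?q"
        using elim(5) run_start_le[of X n \<omega>] run_start_decreasing[of X n \<omega>] by auto
      moreover have "0 < \<kappa> ?r" "\<kappa> ?r \<le> 1" using rec by (auto simp: recurrence1_def)
      moreover have "?E (indicator ?up) \<omega> + ennreal ?q = 1" using elim(1-4) by simp
      ultimately have "?E (indicator ?up) \<omega> \<le> ennreal (1 - \<kappa> ?r)"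
        by (cases "?E (indicator ?up) \<omega>")
          (auto simp flip: ennreal_plus ennreal_1 intro!: ennreal_leI)
      with elim(6) show "nn_cond_exp (P x) (natural_algebra \<Omega> X n) (indicator ?up) \<omega> \<le> ennreal (1 - \<kappa> ?r)"
        by simp
    qed
  qed
qed

lemma cond_jump_moment_le:
  assumes proc: "process_with_laws S \<Omega> P X" and depth: "random_memory_depth S \<Omega> P X"
    and jumps: "upward_jump_moments S \<Omega> P X" and k: "0 < k"
  obtains M where "0 \<le> M" "\<And>x n. x \<in> S \<Longrightarrow> AE \<omega> in P x.
    nn_cond_exp (P x) (natural_algebra \<Omega> X n)
      (\<lambda>\<omega>. ennreal (max (real (X (Suc n) \<omega>) - real (X n \<omega>)) 0 ^ k)) \<omega> \<le> ennreal M"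
proof -
  have "0 < real k" using k by simp
  with jumps[unfolded upward_jump_moments_def, THEN spec, of "real k"]
  obtain M where M: "0 \<le> M" "\<And>x n. x \<in> S \<Longrightarrow> AE \<omega> in P x.
      nn_cond_exp (P x) (memory_algebra \<Omega> X n)
        (\<lambda>\<omega>. ennreal (max (real (X (Suc n) \<omega>) - real (X n \<omega>)) 0 powr real k)) \<omega> \<le> ennreal M"
    by blast
  have "AE \<omega> in P x. nn_cond_exp (P x) (natural_algebra \<Omega> X n)
      (\<lambda>\<omega>. ennreal (max (real (X (Suc n) \<omega>) - real (X n \<omega>)) 0 ^ k)) \<omega> \<le> ennreal M" if "x \<in> S" for x n
  proof -
    have eq: "(\<lambda>\<omega>. ennreal (max (real (X (Suc n) \<omega>) - real (X n \<omega>)) 0 powr real k))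
      = (\<lambda>\<omega>. ennreal (max (real (X (Suc n) \<omega>) - real (X n \<omega>)) 0 ^ k))"
      using k by (simp add: powr_realpow')
    from M(2)[OF that, of n] cond_exp_natural_eq_memory[OF proc that depth refl,
        where h = "\<lambda>a b. ennreal (max (real b - real a) 0 ^ k)" and n = n]
    show ?thesis unfolding eq by eventually_elim simp
  qed
  then show ?thesis using that M(1) by blast
qed

section \<open>Moments of the hitting time\<close>

text \<open>The abstract step applied to the process. On a decrease the position loses at least one and the
credit rises from \<open>D r\<close> to at least \<open>D (r + 1)\<close>, so \<open>Z\<close> loses at least \<open>d r\<close>. Otherwise at most the whole
credit \<open>D r\<close> is lost and the position rises by the jump. The recursion \<open>D_Suc\<close> for \<open>D\<close> is precisely what
makes these two balance up to the surplus \<open>\<kappa> r - \<gamma> \<ge> \<gamma>\<close>.\<close>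

lemma inflated_potential_is_supermartingale:
  fixes \<kappa> D :: "nat \<Rightarrow> real" and B L M2 Mk \<gamma> :: real and X :: "nat \<Rightarrow> 'a \<Rightarrow> nat"
  defines "s i \<equiv> 1 / (real (max 1 i))\<^sup>2"
  defines "Z n \<omega> \<equiv> real (X n \<omega>) + (B - D (n - run_start X n \<omega>)) + \<gamma> * real n + L"
  assumes proc: "process_with_laws S \<Omega> P X" "x \<in> S" and depth: "random_memory_depth S \<Omega> P X"
    and rec: "recurrence1 S \<Omega> P X N \<kappa>"
    and M: "0 \<le> M2" "0 \<le> Mk"
    and J2: "AE \<omega> in P x. nn_cond_exp (P x) (natural_algebra \<Omega> X n)
      (\<lambda>\<omega>. ennreal (max (real (X (Suc n) \<omega>) - real (X n \<omega>)) 0 ^ 2)) \<omega> \<le> ennreal M2"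
    and Jk: "AE \<omega> in P x. nn_cond_exp (P x) (natural_algebra \<Omega> X n)
      (\<lambda>\<omega>. ennreal (max (real (X (Suc n) \<omega>) - real (X n \<omega>)) 0 ^ (k + 2))) \<omega> \<le> ennreal Mk"
    and D: "mono D" "\<And>r. 0 \<le> D r" "\<And>r. D r \<le> B"
    and D_Suc: "\<And>r. D (Suc r) * \<kappa> r = D r + ((1 - \<kappa> r) / s r + s r * M2)"
    and \<gamma>: "0 < \<gamma>" "2 * \<gamma> \<le> \<kappa> 0"
    and L: "1 \<le> L" "real (k + 2) * (1 + B) \<le> L"
      "2 ^ (k + 2) * ((1 + (1 + B)) ^ (k + 2) + Mk) \<le> real (k + 2) * \<gamma> * L"
  shows "(\<integral>\<^sup>+\<omega>. indicator {\<omega> \<in> space (P x). enat n < hitting_time X N \<omega>} \<omega> * ennreal (Z (Suc n) \<omega> ^ (k + 2)) \<partial>P x)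
    \<le> (\<integral>\<^sup>+\<omega>. indicator {\<omega> \<in> space (P x). enat n < hitting_time X N \<omega>} \<omega> * ennreal (Z n \<omega> ^ (k + 2)) \<partial>P x)"
proof -
  note proc' = process_with_lawsD[OF proc]
  interpret prob_space "P x" by (rule proc')
  interpret nat: finite_measure_subalgebra "P x" "natural_algebra \<Omega> X n" by unfold_locales (rule proc')
  let ?F = "natural_algebra \<Omega> X n"
  let ?T = "{\<omega> \<in> space (P x). enat n < hitting_time X N \<omega>}" and ?U = "{\<omega> \<in> space \<Omega>. X n \<omega> \<le> X (Suc n) \<omega>}"
  let ?J = "\<lambda>\<omega>. max (real (X (Suc n) \<omega>) - real (X n \<omega>)) 0"
  let ?r = "\<lambda>\<omega>. n - run_start X n \<omega>"
  define d where "d r = 1 - \<gamma> + D (Suc r) - D r" for r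
  define e where "e r = D r + \<gamma>" for r
  have \<kappa>: "0 < \<kappa> r" "\<kappa> r \<le> 1" "\<kappa> 0 \<le> \<kappa> r" for r
    using rec by (auto simp: recurrence1_def mono_def)
  have s: "0 < s i" for i unfolding s_def by simp
  have [measurable]: "X i \<in> borel_measurable (P x)" for i
    by (rule measurable_compose[OF proc'(3)]) simp
  have XF: "X i \<in> measurable ?F (count_space UNIV)" if "i \<le> n" for i
    using that by (rule natural_algebra_measurable)
  have spaceF: "space ?F = space (P x)" using nat.subalg by (simp add: subalgebra_def)
  have T: "?T \<in> sets ?F"
  proof -
    have "Measurable.pred ?F (\<lambda>\<omega>. \<forall>i\<in>{..n}. N < X i \<omega>)"
    proof (rule pred_intros_finite(3))
      fix i assume "i \<in> {..n}"
      then have [measurable]: "X i \<in> borel_measurable ?F" by (intro measurable_compose[OF XF]) auto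
      show "Measurable.pred ?F (\<lambda>\<omega>. N < X i \<omega>)" by measurable
    qed simp
    moreover have "?T = {\<omega> \<in> space ?F. \<forall>i\<in>{..n}. N < X i \<omega>}"
      by (auto simp: spaceF enat_less_hitting_time_iff)
    ultimately show ?thesis by (simp only: pred_def)
  qed
  have run: "run_start X i \<in> measurable (P x) (count_space UNIV)" for i
    by (rule run_start_measurable) (rule proc')
  have r: "?r \<in> measurable ?F (count_space UNIV)"
    by (rule measurable_compose[OF run_start_natural_measurable]) simp
  have ZF: "Z n \<in> borel_measurable ?F"
  proof -
    have [measurable]: "(\<lambda>\<omega>. real (X n \<omega>)) \<in> borel_measurable ?F" by (rule measurable_compose[OF XF]) simp_all
    have [measurable]: "(\<lambda>\<omega>. D (?r \<omega>)) \<in> borel_measurable ?F" by (rule measurable_compose[OF r]) simp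
    show ?thesis unfolding Z_def by measurable
  qed
  have Z': "Z (Suc n) \<in> borel_measurable (P x)"
  proof -
    have [measurable]: "(\<lambda>\<omega>. D (Suc n - run_start X (Suc n) \<omega>)) \<in> borel_measurable (P x)"
      by (rule measurable_compose[OF run]) simp
    have [measurable]: "(\<lambda>\<omega>. real (X (Suc n) \<omega>)) \<in> borel_measurable (P x)"
      by (rule measurable_compose[OF proc'(3)]) simp
    show ?thesis unfolding Z_def by measurable
  qed
  have ZL: "L \<le> Z i \<omega>" for i \<omega>
    unfolding Z_def using D(3)[of "i - run_start X i \<omega>"] \<gamma> by simp
  have step: "Z (Suc n) \<omega> \<le> Z n \<omega> + (if \<omega> \<in> ?U then ?J \<omega> + e (?r \<omega>) else - d (?r \<omega>))"
    if \<omega>: "\<omega> \<in> ?T" for \<omega>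
  proof (cases "\<omega> \<in> ?U")
    case True
    then have "?J \<omega> = real (X (Suc n) \<omega>) - real (X n \<omega>)" by simp
    with True show ?thesis
      using D(2)[of "Suc n - run_start X (Suc n) \<omega>"] by (simp add: Z_def e_def algebra_simps)
  next
    case False
    then have less: "X (Suc n) \<omega> < X n \<omega>" using \<omega> proc'(2) by auto
    have "Suc (?r \<omega>) \<le> Suc n - run_start X (Suc n) \<omega>"
      using run_start_Suc_le[of X n \<omega>, OF less] run_start_le[of X n \<omega>] by linarith
    then have "D (Suc (?r \<omega>)) \<le> D (Suc n - run_start X (Suc n) \<omega>)" by (rule monoD[OF D(1)])
    moreover have "real (X (Suc n) \<omega>) \<le> real (X n \<omega>) - 1" using less by linarith
    ultimately show ?thesis using False by (simp add: Z_def d_def algebra_simps)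
  qed
  have gain: "(d i + e i + 1 / s i) * (1 - \<kappa> i) + s i * M2 + \<gamma> \<le> d i" for i
  proof -
    have "(d i + e i + 1 / s i) * (1 - \<kappa> i) + s i * M2
        = 1 - \<kappa> i + D (Suc i) - D (Suc i) * \<kappa> i + ((1 - \<kappa> i) / s i + s i * M2)"
      unfolding d_def e_def by (simp add: algebra_simps diff_divide_distrib)
    also have "\<dots> = 1 - \<kappa> i + D (Suc i) - D i" unfolding D_Suc by simp
    finally show ?thesis using \<gamma> \<kappa>(3)[of i] by (simp add: d_def)
  qed
  show ?thesis
  proof (rule nat.drift_step[where J = ?J and U = ?U and d = d and e = e and s = s and \<delta> = "\<lambda>i. 1 - \<kappa> i"
        and r = ?r and A = "1 + B" and L = L and mq = M2 and mk = Mk and \<gamma> = \<gamma>])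
    show "?T \<in> sets ?F" "Z n \<in> borel_measurable ?F" "?r \<in> measurable ?F (count_space UNIV)"
      "Z (Suc n) \<in> borel_measurable (P x)" by (fact T ZF r Z')+
    have [measurable]: "(\<lambda>\<omega>. real (X i \<omega>)) \<in> borel_measurable (P x)" for i
      by (rule measurable_compose[OF proc'(3)]) simp
    note [measurable] = proc'(3)
    show "?J \<in> borel_measurable (P x)" by measurable
    show "?U \<in> sets (P x)" unfolding proc'(2)[symmetric] by measurable
    show "L \<le> Z n \<omega>" "0 \<le> Z (Suc n) \<omega>" for \<omega> using ZL[of n \<omega>] ZL[of "Suc n" \<omega>] L(1) by auto
    show "Z (Suc n) \<omega> \<le> Z n \<omega> + (if \<omega> \<in> ?U then ?J \<omega> + e (?r \<omega>) else - d (?r \<omega>))"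
      if "\<omega> \<in> ?T" for \<omega> by (rule step[OF that])
    show "0 \<le> d i" "d i \<le> 1 + B" for i
      using monoD[OF D(1), of i "Suc i"] D(2)[of i] D(3)[of "Suc i"] \<gamma> \<kappa>(2)[of 0] by (auto simp: d_def)
    show "0 \<le> e i" "e i \<le> 1 + B" for i
      using D(2,3)[of i] \<gamma> \<kappa>(2)[of 0] by (auto simp: e_def)
    show "AE \<omega> in P x. \<omega> \<in> ?T \<longrightarrow> nn_cond_exp (P x) ?F (indicator ?U) \<omega> \<le> ennreal (1 - \<kappa> (?r \<omega>))"
      using cond_prob_not_decreasing_le[OF proc depth rec, of n]
      by eventually_elim (auto simp: enat_less_hitting_time_iff)
    show "AE \<omega> in P x. \<omega> \<in> ?T \<longrightarrow> nn_cond_exp (P x) ?F (\<lambda>\<omega>. ennreal (?J \<omega> ^ 2)) \<omega> \<le> ennreal M2"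
      using J2 by eventually_elim simp
    show "AE \<omega> in P x. \<omega> \<in> ?T \<longrightarrow> nn_cond_exp (P x) ?F (\<lambda>\<omega>. ennreal (?J \<omega> ^ (k + 2))) \<omega> \<le> ennreal Mk"
      using Jk by (rule eventually_mono) blast
    show "0 \<le> 1 - \<kappa> i" for i using \<kappa>(2)[of i] by simp
    show "0 \<le> ?J \<omega>" for \<omega> by simp
  qed (fact s M \<gamma>(1) gain L)+
qed

theorem theorem1:
  fixes S :: "nat set" and \<Omega> :: "'a measure" and P :: "nat \<Rightarrow> 'a measure"
    and X :: "nat \<Rightarrow> 'a \<Rightarrow> nat" and N :: nat and \<kappa> :: "nat \<Rightarrow> real"
  assumes "S = UNIV \<or> (\<exists>N'. S = {0..N'})"
    and "process_with_laws S \<Omega> P X"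
    and "random_memory_depth S \<Omega> P X"
    and "recurrence1 S \<Omega> P X N \<kappa>"
    and "recurrence2 \<kappa>"
    and "upward_jump_moments S \<Omega> P X"
  shows "\<forall>m::real. m > 0 \<longrightarrow> (\<exists>C1 C2 :: real. C1 \<ge> 0 \<and> C2 \<ge> 0 \<and>
           (\<forall>x\<in>S. (\<integral>\<^sup>+\<omega>. enat_powr (hitting_time X N \<omega>) m \<partial>P x)
                    \<le> ennreal (C1 * (C2 + real x powr m))))"
proof (intro allI impI)
  fix m :: real assume m: "m > 0"
  note proc = assms(2) and depth = assms(3) and rec = assms(4) and jumps = assms(6)
  \<comment> \<open>The supermartingale uses the integer exponent \<open>k + 2\<close>, which is at least \<open>m\<close>.\<close>
  define k where "k = nat \<lceil>m\<rceil>"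
  have k: "m \<le> real (k + 2)" unfolding k_def by linarith
  have \<kappa>: "0 < \<kappa> i" "\<kappa> i \<le> 1" for i using rec by (auto simp: recurrence1_def)
  obtain M2 where M2: "0 \<le> M2" "\<And>x n. x \<in> S \<Longrightarrow> AE \<omega> in P x. nn_cond_exp (P x) (natural_algebra \<Omega> X n)
      (\<lambda>\<omega>. ennreal (max (real (X (Suc n) \<omega>) - real (X n \<omega>)) 0 ^ 2)) \<omega> \<le> ennreal M2"
    by (rule cond_jump_moment_le[OF proc depth jumps, of 2]) simp_all
  obtain Mk where Mk: "0 \<le> Mk" "\<And>x n. x \<in> S \<Longrightarrow> AE \<omega> in P x. nn_cond_exp (P x) (natural_algebra \<Omega> X n)
      (\<lambda>\<omega>. ennreal (max (real (X (Suc n) \<omega>) - real (X n \<omega>)) 0 ^ (k + 2))) \<omega> \<le> ennreal Mk"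
    by (rule cond_jump_moment_le[OF proc depth jumps, of "k + 2"]) simp_all
  \<comment> \<open>The maximum keeps the weight positive at \<open>0\<close>; shifting by one then gives the series of the recurrence condition.\<close>
  define s where "s i = 1 / (real (max 1 i))\<^sup>2" for i
  define \<epsilon> where "\<epsilon> i = (1 - \<kappa> i) / s i + s i * M2" for i
  have "summable (\<lambda>i. \<epsilon> (Suc i))"
  proof -
    have "summable (\<lambda>i. real (Suc i) powr 2 * (1 - \<kappa> (Suc i)))"
      using assms(5) unfolding recurrence2_def by (metis zero_less_numeral)
    moreover have "summable (\<lambda>i. inverse (real (Suc i) ^ 2) * M2)"
    proof (rule summable_mult2)
      have "summable (\<lambda>i. inverse (real i ^ 2))" by (rule inverse_power_summable) simp
      then show "summable (\<lambda>i. inverse (real (Suc i) ^ 2))"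
        by (rule summable_Suc_iff[where f = "\<lambda>i. inverse (real i ^ 2)", THEN iffD2])
    qed
    ultimately have "summable (\<lambda>i. real (Suc i) powr 2 * (1 - \<kappa> (Suc i)) + inverse (real (Suc i) ^ 2) * M2)"
      by (rule summable_add)
    moreover have "real (Suc i) powr 2 = real (Suc i) ^ 2" for i by (rule powr_numeral) simp
    ultimately show ?thesis by (simp add: \<epsilon>_def s_def max_def field_simps del: of_nat_Suc)
  qed
  then have \<epsilon>: "summable \<epsilon>" by (simp only: summable_Suc_iff)
  have \<epsilon>0: "0 \<le> \<epsilon> i" for i
    using \<kappa>(2)[of i] M2(1) by (simp add: \<epsilon>_def s_def)
  have conv: "convergent_prod \<kappa>" "prodinf \<kappa> > 0" using assms(5) unfolding recurrence2_def by blast+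
  obtain D B where D: "D 0 = 0" "\<And>r. D (Suc r) * \<kappa> r = D r + \<epsilon> r" "mono D" "\<And>r. 0 \<le> D r" "\<And>r. D r \<le> B"
    using bounded_run_potential[OF \<kappa> conv \<epsilon>0 \<epsilon>] by blast
  have B: "0 \<le> B" using D(1) D(5)[of 0] by simp
  define \<gamma> where "\<gamma> = \<kappa> 0 / 2"
  have \<gamma>: "0 < \<gamma>" "2 * \<gamma> \<le> \<kappa> 0" using \<kappa>[of 0] by (auto simp: \<gamma>_def)
  \<comment> \<open>\<open>L\<close> is the sum of three bounds, each of which it has to exceed; \<open>Q\<close> bounds the second-order terms.\<close>
  define Q where "Q = 2 ^ (k + 2) * ((1 + (1 + B)) ^ (k + 2) + Mk)"
  define L where "L = 1 + real (k + 2) * (1 + B) + Q / (real (k + 2) * \<gamma>)"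
  have Q: "0 \<le> Q" unfolding Q_def using B Mk(1) by simp
  have "0 \<le> Q / (real (k + 2) * \<gamma>)" using Q \<gamma> by simp
  moreover have "0 \<le> real (k + 2) * (1 + B)" using B by simp
  ultimately have L: "1 \<le> L" "real (k + 2) * (1 + B) \<le> L" and "Q / (real (k + 2) * \<gamma>) \<le> L"
    unfolding L_def by linarith+
  then have L3: "2 ^ (k + 2) * ((1 + (1 + B)) ^ (k + 2) + Mk) \<le> real (k + 2) * \<gamma> * L"
    unfolding Q_def[symmetric] using \<gamma> by (simp add: pos_divide_le_eq mult.commute)
  define Z where "Z n \<omega> = real (X n \<omega>) + (B - D (n - run_start X n \<omega>)) + \<gamma> * real n + L" for n \<omega>
  let ?C1 = "2 powr m * (1 + 1 / \<gamma> ^ (k + 2))" and ?C2 = "(B + L) powr m"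
  have "(\<integral>\<^sup>+\<omega>. enat_powr (hitting_time X N \<omega>) m \<partial>P x) \<le> ennreal (?C1 * (?C2 + real x powr m))"
    if x: "x \<in> S" for x
  proof -
    note proc' = process_with_lawsD[OF proc x]
    interpret prob_space "P x" by (rule proc')
    let ?\<tau> = "hitting_time X N" and ?s = "real x + (B + L)"
    have T: "{\<omega> \<in> space (P x). enat n < ?\<tau> \<omega>} \<in> sets (P x)" for n
    proof -
      have [measurable]: "X i \<in> borel_measurable (P x)" for i
        by (rule measurable_compose[OF proc'(3)]) simp
      show ?thesis unfolding enat_less_hitting_time_iff by measurable
    qed
    have ZM: "Z n \<in> borel_measurable (P x)" for n
    proof -
      have [measurable]: "(\<lambda>\<omega>. real (X n \<omega>)) \<in> borel_measurable (P x)"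
        by (rule measurable_compose[OF proc'(3)]) simp
      have [measurable]: "(\<lambda>\<omega>. D (n - run_start X n \<omega>)) \<in> borel_measurable (P x)"
        by (rule measurable_compose[OF run_start_measurable[OF proc'(3)]]) simp
      show ?thesis unfolding Z_def by measurable
    qed
    have Z_ge: "\<gamma> * real n \<le> Z n \<omega>" for n \<omega>
      unfolding Z_def using D(5)[of "n - run_start X n \<omega>"] L(1) by simp
    have super: "(\<integral>\<^sup>+\<omega>. indicator {\<omega> \<in> space (P x). enat n < ?\<tau> \<omega>} \<omega> * ennreal (Z (Suc n) \<omega> ^ (k + 2)) \<partial>P x)
        \<le> (\<integral>\<^sup>+\<omega>. indicator {\<omega> \<in> space (P x). enat n < ?\<tau> \<omega>} \<omega> * ennreal (Z n \<omega> ^ (k + 2)) \<partial>P x)" for n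
      unfolding Z_def
      by (rule inflated_potential_is_supermartingale[OF proc x depth rec M2(1) Mk(1) M2(2)[OF x] Mk(2)[OF x]
            D(3-5) D(2)[unfolded \<epsilon>_def s_def] \<gamma> L L3])
    have "AE \<omega> in P x. ennreal (Z 0 \<omega> ^ (k + 2)) = ennreal (?s ^ (k + 2))"
      using proc'(4) by eventually_elim (simp add: Z_def D(1) add.assoc)
    then have Z0: "(\<integral>\<^sup>+\<omega>. ennreal (Z 0 \<omega> ^ (k + 2)) \<partial>P x) = (\<integral>\<^sup>+\<omega>. ennreal (?s ^ (k + 2)) \<partial>P x)"
      by (rule nn_integral_cong_AE)
    have "(\<integral>\<^sup>+\<omega>. enat_powr (?\<tau> \<omega>) m \<partial>P x) \<le> ennreal (?s powr m * (1 + 1 / \<gamma> ^ (k + 2)))"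
    proof (rule moment_of_truncated_moments[OF prob_space_axioms T _ \<gamma>(1) m k])
      show "0 < ?s" using B L(1) by simp
      show "(\<integral>\<^sup>+\<omega>. ennreal ((\<gamma> * real (the_enat (min (enat n) (?\<tau> \<omega>)))) ^ (k + 2)) \<partial>P x) \<le> ennreal (?s ^ (k + 2))" for n
      proof -
        have "(\<integral>\<^sup>+\<omega>. ennreal ((\<gamma> * real (the_enat (min (enat n) (?\<tau> \<omega>)))) ^ (k + 2)) \<partial>P x)
            \<le> (\<integral>\<^sup>+\<omega>. ennreal (Z 0 \<omega> ^ (k + 2)) \<partial>P x)"
          by (rule truncated_time_moment[OF T ZM Z_ge _ super]) (use \<gamma>(1) in simp_all)
        also have "\<dots> = ennreal (?s ^ (k + 2))" unfolding Z0 by (simp add: emeasure_space_1)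
        finally show ?thesis .
      qed
    qed simp
    also have "\<dots> \<le> ennreal (?C1 * (?C2 + real x powr m))"
    proof (rule ennreal_leI)
      have "?s powr m \<le> 2 powr m * (real x powr m + (B + L) powr m)"
        using B L(1) m by (intro powr_add_le_two_powr) auto
      then have "?s powr m * (1 + 1 / \<gamma> ^ (k + 2))
          \<le> 2 powr m * (real x powr m + (B + L) powr m) * (1 + 1 / \<gamma> ^ (k + 2))"
        using \<gamma>(1) by (intro mult_right_mono) auto
      then show "?s powr m * (1 + 1 / \<gamma> ^ (k + 2)) \<le> ?C1 * (?C2 + real x powr m)"
        by (simp only: mult.assoc mult.commute mult.left_commute add.commute)
    qed
    finally show ?thesis .
  qed
  moreover have "0 \<le> ?C1" "0 \<le> ?C2" using \<gamma>(1) by simp_all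
  ultimately show "\<exists>C1 C2 :: real. C1 \<ge> 0 \<and> C2 \<ge> 0 \<and>
      (\<forall>x\<in>S. (\<integral>\<^sup>+\<omega>. enat_powr (hitting_time X N \<omega>) m \<partial>P x) \<le> ennreal (C1 * (C2 + real x powr m)))"
    by blast
qed

end
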